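(* The map $I_n: W^{\otimes n}\to\bigwedge(W_n\oplus W_n)$ is an isomorphism of $\mathbb{C}[B_n]$-modules. That is, $I_n$ is a linear isomorphism and for any $b\in B_n$, $$\Psi_n(b)\circ I_n = I_n\circ b_R^n(b).$$
   Context: The base field is $\mathbb{C}(t_0^{1/2})$ and $n\ge 1$. $B_n$ is the braid group with Artin generators $\sigma_1,\dots,\sigma_{n-1}$. **Specialized R-matrix representation $b_R^n$ (at $t_1=t_0^{-1}$).** Let $W$ have basis $e_1,\dots,e_4$, write $e_{ij}=e_i\otimes e_j$ and $Y=t_0^{1/2}-t_0^{-1/2}$. The automorphism $R$ of $W\otimes W$ is $R(e_{11})=-t_0e_{11}$; $R(e_{44})=-t_0^{-1}e_{44}$; $R(e_{22})=e_{22}$; $R(e_{33})=e_{33}$; $R(e_{12})=-t_0^{1/2}e_{21}$; $R(e_{21})=-t_0^{1/2}e_{12}+(1-t_0)e_{21}$; $R(e_{13})=-t_0^{1/2}e_{31}$; $R(e_{31})=-t_0^{1/2}e_{13}+(1-t_0)e_{31}$; $R(e_{34})=t_0^{-1/2}e_{43}$; $R(e_{43})=t_0^{-1/2}e_{34}+(1-t_0^{-1})e_{43}$; $R(e_{24})=t_0^{-1/2}e_{42}$; $R(e_{42})=t_0^{-1/2}e_{24}+(1-t_0^{-1})e_{42}$; $R(e_{14})=-e_{41}$; $R(e_{23})=-e_{32}-Ye_{41}$; $R(e_{32})=-e_{23}-Ye_{41}$; $R(e_{41})=-e_{14}-Ye_{23}-Ye_{32}-Y^2e_{41}$. $R$ satisfies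 the Yang-Baxter equation, and $b_R^n:B_n\to GL(W^{\otimes n})$ is $b_R^n(\sigma_i)=\mathrm{id}_W^{\otimes i-1}\otimes R\otimes\mathrm{id}_W^{\otimes n-i-1}$. **Exterior representation $\Psi_n$.** On the first copy of $W_n$, with basis $f_1,\dots,f_n$, let $F$ be the representation $F(\sigma_i)(f_i)=(1-t_0^{-1})f_i+t_0^{-1/2}f_{i+1}$, $F(\sigma_i)(f_{i+1})=t_0^{-1/2}f_i$, $F(\sigma_i)(f_j)=f_j$ otherwise. On the second copy, with basis $g_1,\dots,g_n$, let $G$ be the representation $G(\sigma_i)(g_i)=-t_0^{1/2}g_{i+1}$, $G(\sigma_i)(g_{i+1})=-t_0^{1/2}g_i+(1-t_0)g_{i+1}$, $G(\sigma_i)(g_j)=g_j$ otherwise. Then $\Psi_n:=\bigwedge(F\oplus G)$ is the induced representation of $B_n$ on the exterior algebra $\bigwedge(W_n\oplus W_n)$. **The map $I_n$.** $I_n$ is the linear map defined on basis vectors by $$I_n(e_{i_1}\otimes\cdots\otimes e_{i_n})=\Big(\bigwedge_{k:\ i_k\in\{3,4\}}f_k\Big)\wedge\Big(\bigwedge_{k:\ i_k\in\{1,3\}}g_k\Big),$$ where both wedge products are taken in increasing order of $k$ (an empty product is $1$). *)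

theory Defs
  imports
    "HOL-Algebra.Bij"
    "HOL-Computational_Algebra.Fraction_Field"
    "HOL-Computational_Algebra.Polynomial"
    "HOL-Library.Function_Algebras"
begin

section \<open>Free vector spaces and their automorphism groups\<close>

text \<open>
  The vector space with basis \<open>X\<close> consists of the coordinate functions that vanish outside \<open>X\<close>
  (all index sets below are finite).  Addition of coordinate functions is the pointwise one of
  \<^theory>\<open>HOL-Library.Function_Algebras\<close>.
\<close>

definition smul :: "'k::field \<Rightarrow> ('x \<Rightarrow> 'k) \<Rightarrow> 'x \<Rightarrow> 'k"  (infixr \<open>\<cdot>\<^sub>v\<close> 75)
  where "c \<cdot>\<^sub>v v = (\<lambda>x. c * v x)"

definition free_space :: "'x set \<Rightarrow> ('x \<Rightarrow> 'k::field) set"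
  where "free_space X = {v. \<forall>x. x \<notin> X \<longrightarrow> v x = 0}"

definition bvec :: "'x \<Rightarrow> 'x \<Rightarrow> 'k::field"
  where "bvec x = (\<lambda>y. if y = x then 1 else 0)"

definition lin_ext :: "'x set \<Rightarrow> ('x \<Rightarrow> 'y \<Rightarrow> 'k::field) \<Rightarrow> ('x \<Rightarrow> 'k) \<Rightarrow> 'y \<Rightarrow> 'k"
  where "lin_ext X \<phi> v = (\<Sum>x\<in>X. v x \<cdot>\<^sub>v \<phi> x)"

definition linear_on :: "('x \<Rightarrow> 'k::field) set \<Rightarrow> (('x \<Rightarrow> 'k) \<Rightarrow> 'y \<Rightarrow> 'k) \<Rightarrow> bool"
  where "linear_on V T \<longleftrightarrow>
    (\<forall>u\<in>V. \<forall>v\<in>V. T (u + v) = T u + T v) \<and> (\<forall>c. \<forall>v\<in>V. T (c \<cdot>\<^sub>v v) = c \<cdot>\<^sub>v T v)"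

definition GL :: "('x \<Rightarrow> 'k::field) set \<Rightarrow> (('x \<Rightarrow> 'k) \<Rightarrow> 'x \<Rightarrow> 'k) monoid"
  where "GL V = BijGroup V \<lparr>carrier := {T \<in> Bij V. linear_on V T}\<rparr>"

lemma free_space_add: "u \<in> free_space X \<Longrightarrow> v \<in> free_space X \<Longrightarrow> u + v \<in> free_space X"
  by (simp add: free_space_def)

lemma free_space_smul: "v \<in> free_space X \<Longrightarrow> c \<cdot>\<^sub>v v \<in> free_space X"
  by (simp add: free_space_def smul_def)

lemma lin_ext_bvec:
  assumes "finite X" "x \<in> X"
  shows "lin_ext X \<phi> (bvec x) = \<phi> x"
proof -
  have "lin_ext X \<phi> (bvec x) = (\<Sum>y\<in>X. if y = x then \<phi> x else 0)"
    unfolding lin_ext_def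
    by (rule sum.cong) (auto simp: bvec_def smul_def fun_eq_iff)
  then show ?thesis using assms by simp
qed

lemma linear_on_lin_ext: "linear_on V (lin_ext X \<phi>)"
proof -
  have app: "(\<Sum>x\<in>A. g x) y = (\<Sum>x\<in>A. g x y)" for A and g :: "'a \<Rightarrow> 'c \<Rightarrow> 'b" and y
    by (induction A rule: infinite_finite_induct) auto
  show ?thesis
    by (auto simp: linear_on_def lin_ext_def smul_def fun_eq_iff app sum.distrib
        sum_distrib_left algebra_simps)
qed

lemma group_GL: "group (GL (free_space X))"
proof -
  let ?V = "free_space X :: ('a \<Rightarrow> 'b) set"
  interpret B: group "BijGroup ?V" by (rule group_BijGroup)
  have bij: "T \<in> Bij ?V \<Longrightarrow> u \<in> ?V \<Longrightarrow> T u \<in> ?V" for T u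
    by (auto simp: Bij_def bij_betw_def)
  have "subgroup {T \<in> Bij ?V. linear_on ?V T} (BijGroup ?V)"
  proof (rule B.subgroupI)
    show "{T \<in> Bij ?V. linear_on ?V T} \<subseteq> carrier (BijGroup ?V)"
      by (auto simp: BijGroup_def)
    have "(\<lambda>v\<in>?V. v) \<in> {T \<in> Bij ?V. linear_on ?V T}"
      using id_Bij by (auto simp: linear_on_def free_space_add free_space_smul)
    then show "{T \<in> Bij ?V. linear_on ?V T} \<noteq> {}" by blast
  next
    fix T assume "T \<in> {T \<in> Bij ?V. linear_on ?V T}"
    then have T: "T \<in> Bij ?V" "linear_on ?V T" by auto
    let ?S = "\<lambda>v\<in>?V. inv_into ?V T v"
    have inj: "inj_on T ?V" and surj: "T ` ?V = ?V"
      using T(1) by (auto simp: Bij_def bij_betw_def)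
    have S: "inv_into ?V T v \<in> ?V" "T (inv_into ?V T v) = v" if "v \<in> ?V" for v
      using that surj by (auto simp: inv_into_into f_inv_into_f)
    have "linear_on ?V ?S"
      unfolding linear_on_def
    proof (intro conjI ballI allI)
      fix u v assume uv: "u \<in> ?V" "v \<in> ?V"
      have "T (inv_into ?V T u + inv_into ?V T v) = u + v"
        using T(2) S uv by (auto simp: linear_on_def)
      then have "inv_into ?V T (u + v) = inv_into ?V T u + inv_into ?V T v"
        using inv_into_f_f[OF inj] S uv by (metis free_space_add)
      then show "?S (u + v) = ?S u + ?S v"
        using uv by (simp add: free_space_add)
    next
      fix c v assume v: "v \<in> ?V"
      have "T (c \<cdot>\<^sub>v inv_into ?V T v) = c \<cdot>\<^sub>v v"
        using T(2) S v by (auto simp: linear_on_def)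
      then have "inv_into ?V T (c \<cdot>\<^sub>v v) = c \<cdot>\<^sub>v inv_into ?V T v"
        using inv_into_f_f[OF inj] S v by (metis free_space_smul)
      then show "?S (c \<cdot>\<^sub>v v) = c \<cdot>\<^sub>v ?S v"
        using v by (simp add: free_space_smul)
    qed
    then show "inv\<^bsub>BijGroup ?V\<^esub> T \<in> {T \<in> Bij ?V. linear_on ?V T}"
      using T(1) by (simp add: inv_BijGroup restrict_inv_into_Bij)
  next
    fix S T assume "S \<in> {T \<in> Bij ?V. linear_on ?V T}" "T \<in> {T \<in> Bij ?V. linear_on ?V T}"
    then have ST: "S \<in> Bij ?V" "linear_on ?V S" "T \<in> Bij ?V" "linear_on ?V T" by auto
    then have "linear_on ?V (compose ?V S T)"
      using bij[OF ST(3)]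
      by (auto simp: linear_on_def compose_def free_space_add free_space_smul)
    then show "S \<otimes>\<^bsub>BijGroup ?V\<^esub> T \<in> {T \<in> Bij ?V. linear_on ?V T}"
      using ST by (simp add: BijGroup_def compose_Bij)
  qed
  then show ?thesis
    unfolding GL_def by (rule B.subgroup_imp_group)
qed


section \<open>The braid group\<close>

text \<open>
  Artin presentation.  In a word the letter \<open>(i, True)\<close> stands for the generator \<open>\<sigma>\<^sub>i\<close>
  and \<open>(i, False)\<close> for its inverse, where \<open>1 \<le> i < n\<close>.
\<close>

type_synonym braid_word = "(nat \<times> bool) list"

definition braid_words :: "nat \<Rightarrow> braid_word set"
  where "braid_words n = lists ({1..<n} \<times> UNIV)"

inductive braid_cong :: "nat \<Rightarrow> braid_word \<Rightarrow> braid_word \<Rightarrow> bool" for n where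
  refl: "braid_cong n u u"
| sym: "braid_cong n u v \<Longrightarrow> braid_cong n v u"
| trans: "braid_cong n u v \<Longrightarrow> braid_cong n v w \<Longrightarrow> braid_cong n u w"
| ctxt: "braid_cong n u v \<Longrightarrow> braid_cong n (p @ u @ q) (p @ v @ q)"
| cancel: "i \<in> {1..<n} \<Longrightarrow> braid_cong n [(i, e), (i, \<not> e)] []"
| commute: "i \<in> {1..<n} \<Longrightarrow> j \<in> {1..<n} \<Longrightarrow> i + 1 < j \<Longrightarrow>
    braid_cong n [(i, True), (j, True)] [(j, True), (i, True)]"
| braid: "1 \<le> i \<Longrightarrow> i + 1 < n \<Longrightarrow>
    braid_cong n [(i, True), (i + 1, True), (i, True)] [(i + 1, True), (i, True), (i + 1, True)]"

definition braid_rel :: "nat \<Rightarrow> (braid_word \<times> braid_word) set"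
  where "braid_rel n = {(u, v). u \<in> braid_words n \<and> v \<in> braid_words n \<and> braid_cong n u v}"

definition braid_group :: "nat \<Rightarrow> braid_word set monoid"
  where "braid_group n =
    \<lparr>carrier = braid_words n // braid_rel n,
     monoid.mult = (\<lambda>A B. braid_rel n `` {u @ v | u v. u \<in> A \<and> v \<in> B}),
     one = braid_rel n `` {[]}\<rparr>"

definition braid_gen :: "nat \<Rightarrow> nat \<Rightarrow> braid_word set"
  where "braid_gen n i = braid_rel n `` {[(i, True)]}"

definition word_eval :: "('g, 'm) monoid_scheme \<Rightarrow> (nat \<Rightarrow> 'g) \<Rightarrow> braid_word \<Rightarrow> 'g"
  where "word_eval G s w =
    foldr (\<lambda>(i, e) g. (if e then s i else inv\<^bsub>G\<^esub> (s i)) \<otimes>\<^bsub>G\<^esub> g) w \<one>\<^bsub>G\<^esub>"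

text \<open>
  The homomorphism \<open>B\<^sub>n \<rightarrow> G\<close> with \<open>\<sigma>\<^sub>i \<mapsto> s i\<close>.  It is meaningful when the \<open>s i\<close> satisfy the
  braid relations; see \<open>braid_lift_hom\<close>, \<open>braid_lift_gen\<close>, \<open>braid_lift_unique\<close> below.
\<close>

definition braid_lift :: "nat \<Rightarrow> ('g, 'm) monoid_scheme \<Rightarrow> (nat \<Rightarrow> 'g) \<Rightarrow> braid_word set \<Rightarrow> 'g"
  where "braid_lift n G s = (\<lambda>b\<in>carrier (braid_group n). the_elem (word_eval G s ` b))"

lemma braid_words_append [simp]:
  "u @ v \<in> braid_words n \<longleftrightarrow> u \<in> braid_words n \<and> v \<in> braid_words n"
  by (auto simp: braid_words_def)

lemma braid_words_Nil [simp]: "[] \<in> braid_words n"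
  by (simp add: braid_words_def)

lemma braid_words_Cons [simp]:
  "(i, e) # w \<in> braid_words n \<longleftrightarrow> i \<in> {1..<n} \<and> w \<in> braid_words n"
  by (auto simp: braid_words_def)

lemma braid_cong_append:
  assumes "braid_cong n u u'" "braid_cong n v v'"
  shows "braid_cong n (u @ v) (u' @ v')"
  using braid_cong.ctxt[OF assms(1), of "[]" v] braid_cong.ctxt[OF assms(2), of u' "[]"]
  by (auto intro: braid_cong.trans)

lemma equiv_braid_rel: "equiv (braid_words n) (braid_rel n)"
  by (rule equivI)
    (auto simp: braid_rel_def refl_on_def sym_def trans_def
      intro: braid_cong.refl braid_cong.sym braid_cong.trans)

lemma braid_class_mult:
  assumes "u \<in> braid_words n" "v \<in> braid_words n"
  shows "braid_rel n `` {u} \<otimes>\<^bsub>braid_group n\<^esub> braid_rel n `` {v} = braid_rel n `` {u @ v}"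
proof -
  have "(u @ v, w) \<in> braid_rel n" if "(u, u') \<in> braid_rel n" "(v, v') \<in> braid_rel n"
    "(u' @ v', w) \<in> braid_rel n" for u' v' w
    using that by (auto simp: braid_rel_def intro: braid_cong.trans braid_cong_append)
  moreover have "(u, u) \<in> braid_rel n" "(v, v) \<in> braid_rel n"
    using assms by (auto simp: braid_rel_def intro: braid_cong.refl)
  ultimately show ?thesis
    by (auto simp: braid_group_def)
qed

lemma carrier_braid_group:
  "b \<in> carrier (braid_group n) \<longleftrightarrow> (\<exists>w\<in>braid_words n. b = braid_rel n `` {w})"
  by (auto simp: braid_group_def quotient_def)

lemma braid_word_inverse:
  "w \<in> braid_words n \<Longrightarrow> \<exists>w'\<in>braid_words n. braid_cong n (w' @ w) []"
proof (induction w)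
  case Nil
  show ?case by (rule bexI[of _ "[]"]) (auto intro: braid_cong.refl)
next
  case (Cons a w)
  obtain i e where a: "a = (i, e)" by force
  from Cons a obtain w' where w': "w' \<in> braid_words n" "braid_cong n (w' @ w) []" by auto
  have i: "i \<in> {1..<n}" using Cons.prems a by simp
  have "braid_cong n (w' @ [(i, \<not> e), (i, \<not> \<not> e)] @ w) (w' @ [] @ w)"
    by (intro braid_cong.ctxt braid_cong.cancel i)
  then have "braid_cong n ((w' @ [(i, \<not> e)]) @ a # w) []"
    using w'(2) a by (auto intro: braid_cong.trans)
  then show ?case
    using w'(1) i by (intro bexI[of _ "w' @ [(i, \<not> e)]"]) auto
qed

lemma braid_class_eqI:
  "u \<in> braid_words n \<Longrightarrow> v \<in> braid_words n \<Longrightarrow> braid_cong n u v \<Longrightarrow>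
    braid_rel n `` {u} = braid_rel n `` {v}"
  by (rule equiv_class_eq[OF equiv_braid_rel]) (simp add: braid_rel_def)

lemma group_braid_group: "group (braid_group n)"
proof (rule groupI)
  have one: "\<one>\<^bsub>braid_group n\<^esub> = braid_rel n `` {[]}" by (simp add: braid_group_def)
  show "\<one>\<^bsub>braid_group n\<^esub> \<in> carrier (braid_group n)"
    unfolding one carrier_braid_group by force
  fix a assume a: "a \<in> carrier (braid_group n)"
  then obtain u where u: "u \<in> braid_words n" "a = braid_rel n `` {u}"
    by (auto simp: carrier_braid_group)
  show "\<one>\<^bsub>braid_group n\<^esub> \<otimes>\<^bsub>braid_group n\<^esub> a = a"
    unfolding one using u by (simp add: braid_class_mult)
  obtain u' where u': "u' \<in> braid_words n" "braid_cong n (u' @ u) []"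
    using braid_word_inverse[OF u(1)] by blast
  then have "braid_rel n `` {u'} \<otimes>\<^bsub>braid_group n\<^esub> a = \<one>\<^bsub>braid_group n\<^esub>"
    unfolding one using u by (simp add: braid_class_mult braid_class_eqI)
  then show "\<exists>y\<in>carrier (braid_group n). y \<otimes>\<^bsub>braid_group n\<^esub> a = \<one>\<^bsub>braid_group n\<^esub>"
    using u'(1) by (intro bexI[of _ "braid_rel n `` {u'}"]) (auto simp: carrier_braid_group)
  fix b assume b: "b \<in> carrier (braid_group n)"
  then obtain v where v: "v \<in> braid_words n" "b = braid_rel n `` {v}"
    by (auto simp: carrier_braid_group)
  show "a \<otimes>\<^bsub>braid_group n\<^esub> b \<in> carrier (braid_group n)"
    using u v by (auto simp: carrier_braid_group braid_class_mult)
  fix c assume "c \<in> carrier (braid_group n)"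
  then obtain w where w: "w \<in> braid_words n" "c = braid_rel n `` {w}"
    by (auto simp: carrier_braid_group)
  show "a \<otimes>\<^bsub>braid_group n\<^esub> b \<otimes>\<^bsub>braid_group n\<^esub> c = a \<otimes>\<^bsub>braid_group n\<^esub> (b \<otimes>\<^bsub>braid_group n\<^esub> c)"
    using u v w by (simp add: braid_class_mult)
qed

definition braid_images :: "nat \<Rightarrow> ('g, 'm) monoid_scheme \<Rightarrow> (nat \<Rightarrow> 'g) \<Rightarrow> bool"
  where "braid_images n G s \<longleftrightarrow>
    (\<forall>i\<in>{1..<n}. s i \<in> carrier G) \<and>
    (\<forall>i\<in>{1..<n}. \<forall>j\<in>{1..<n}. i + 1 < j \<longrightarrow> s i \<otimes>\<^bsub>G\<^esub> s j = s j \<otimes>\<^bsub>G\<^esub> s i) \<and>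
    (\<forall>i. 1 \<le> i \<and> i + 1 < n \<longrightarrow>
      s i \<otimes>\<^bsub>G\<^esub> (s (i + 1) \<otimes>\<^bsub>G\<^esub> s i) = s (i + 1) \<otimes>\<^bsub>G\<^esub> (s i \<otimes>\<^bsub>G\<^esub> s (i + 1)))"

context
  fixes n :: nat and G :: "('g, 'm) monoid_scheme" (structure) and s :: "nat \<Rightarrow> 'g"
  assumes G: "group G" and s: "braid_images n G s"
begin

interpretation group G by (rule G)

lemma braid_images_closed: "i \<in> {1..<n} \<Longrightarrow> s i \<in> carrier G"
  using s unfolding braid_images_def by blast

lemma word_eval_Nil: "word_eval G s [] = \<one>"
  by (simp add: word_eval_def)

lemma word_eval_Cons:
  "word_eval G s ((i, e) # w) = (if e then s i else inv (s i)) \<otimes> word_eval G s w"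
  by (simp add: word_eval_def)

lemma word_eval_closed: "w \<in> braid_words n \<Longrightarrow> word_eval G s w \<in> carrier G"
proof (induction w)
  case (Cons a w)
  then show ?case
    by (cases a) (auto simp: word_eval_Cons intro!: m_closed inv_closed braid_images_closed)
qed (simp add: word_eval_Nil)

lemma word_eval_append:
  "u \<in> braid_words n \<Longrightarrow> v \<in> braid_words n \<Longrightarrow>
    word_eval G s (u @ v) = word_eval G s u \<otimes> word_eval G s v"
proof (induction u)
  case (Cons a u)
  obtain i e where a: "a = (i, e)" by force
  have "s i \<in> carrier G" using Cons.prems a by (intro braid_images_closed) simp
  then show ?case
    using Cons a by (auto simp: word_eval_Cons word_eval_closed m_assoc)
qed (simp add: word_eval_Nil word_eval_closed)

lemma word_eval_cong:
  "braid_cong n u v \<Longrightarrow>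
    (u \<in> braid_words n \<longleftrightarrow> v \<in> braid_words n) \<and>
    (u \<in> braid_words n \<longrightarrow> word_eval G s u = word_eval G s v)"
proof (induction rule: braid_cong.induct)
  case (cancel i e)
  then show ?case
    using braid_images_closed[of i] by (auto simp: word_eval_Cons word_eval_Nil)
next
  case (commute i j)
  then have "s i \<otimes> s j = s j \<otimes> s i"
    using s unfolding braid_images_def by blast
  then show ?case
    using commute braid_images_closed[of i] braid_images_closed[of j]
    by (auto simp: word_eval_Cons word_eval_Nil)
next
  case (braid i)
  then have "i \<in> {1..<n}" "i + 1 \<in> {1..<n}"
    "s i \<otimes> (s (i + 1) \<otimes> s i) = s (i + 1) \<otimes> (s i \<otimes> s (i + 1))"
    using s unfolding braid_images_def by auto
  then show ?case
    using braid_images_closed[of i] braid_images_closed[of "i + 1"]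
    by (auto simp: word_eval_Cons word_eval_Nil)
qed (auto simp: word_eval_append)

lemma braid_lift_class:
  assumes "w \<in> braid_words n"
  shows "braid_lift n G s (braid_rel n `` {w}) = word_eval G s w"
proof -
  have "word_eval G s ` (braid_rel n `` {w}) = {word_eval G s w}"
    using assms by (auto simp: braid_rel_def dest!: word_eval_cong intro!: image_eqI[of _ _ w]
        intro: braid_cong.refl)
  moreover have "braid_rel n `` {w} \<in> carrier (braid_group n)"
    using assms by (auto simp: carrier_braid_group)
  ultimately show ?thesis by (simp add: braid_lift_def)
qed

lemma braid_lift_hom: "braid_lift n G s \<in> hom (braid_group n) G"
  by (rule homI)
    (auto simp: carrier_braid_group braid_lift_class word_eval_closed braid_class_mult
      word_eval_append)

lemma braid_lift_gen: "i \<in> {1..<n} \<Longrightarrow> braid_lift n G s (braid_gen n i) = s i"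
  unfolding braid_gen_def
  by (subst braid_lift_class)
    (auto simp: word_eval_Cons word_eval_Nil intro!: r_one braid_images_closed)

lemma braid_lift_unique:
  assumes h: "h \<in> hom (braid_group n) G"
    and gen: "\<And>i. i \<in> {1..<n} \<Longrightarrow> h (braid_gen n i) = s i"
    and b: "b \<in> carrier (braid_group n)"
  shows "h b = braid_lift n G s b"
proof -
  interpret B: group "braid_group n" by (rule group_braid_group)
  interpret h: group_hom "braid_group n" G h
    by unfold_locales (rule h)
  have one: "\<one>\<^bsub>braid_group n\<^esub> = braid_rel n `` {[]}" by (simp add: braid_group_def)
  have in_carr: "braid_rel n `` {w} \<in> carrier (braid_group n)" if "w \<in> braid_words n" for w
    using that by (auto simp: carrier_braid_group)
  have letter: "h (braid_rel n `` {[(i, e)]}) = (if e then s i else inv (s i))"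
    if i: "i \<in> {1..<n}" for i e
  proof (cases e)
    case True
    then show ?thesis using gen[OF i] by (simp add: braid_gen_def)
  next
    case False
    have "braid_rel n `` {[(i, False)]} \<otimes>\<^bsub>braid_group n\<^esub> braid_gen n i = \<one>\<^bsub>braid_group n\<^esub>"
      unfolding one braid_gen_def
      using i braid_cong.cancel[of i n False] by (simp add: braid_class_mult braid_class_eqI)
    then have "braid_rel n `` {[(i, False)]} = inv\<^bsub>braid_group n\<^esub> braid_gen n i"
      using i by (intro B.inv_equality[symmetric]) (auto simp: braid_gen_def intro!: in_carr)
    moreover have "braid_gen n i \<in> carrier (braid_group n)"
      using i by (auto simp: braid_gen_def intro!: in_carr)
    ultimately show ?thesis using False gen[OF i] by simp
  qed
  have "h (braid_rel n `` {w}) = word_eval G s w" if "w \<in> braid_words n" for w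
    using that
  proof (induction w)
    case Nil
    show ?case using h.hom_one by (simp add: word_eval_Nil one)
  next
    case (Cons a w)
    obtain i e where a: "a = (i, e)" by force
    with Cons.prems have i: "i \<in> {1..<n}" and w: "w \<in> braid_words n" by auto
    have "h (braid_rel n `` {[(i, e)]} \<otimes>\<^bsub>braid_group n\<^esub> braid_rel n `` {w}) =
        h (braid_rel n `` {[(i, e)]}) \<otimes> h (braid_rel n `` {w})"
      using i w by (intro h.hom_mult in_carr) auto
    then show ?case
      using Cons.IH[OF w] letter[OF i, of e] i w a
      by (simp add: braid_class_mult word_eval_Cons)
  qed
  then show ?thesis
    using b by (auto simp: carrier_braid_group braid_lift_class)
qed

end


section \<open>The base field\<close>

type_synonym ratfun = "complex poly fract"

text \<open>The field of rational functions in one variable; the variable is \<open>t\<^sub>0\<^sup>1\<^sup>/\<^sup>2\<close>.\<close>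

definition t0_half :: ratfun
  where "t0_half = Fraction_Field.Fract [:0, 1:] 1"

definition t0 :: ratfun
  where "t0 = t0_half ^ 2"

definition Y :: ratfun
  where "Y = t0_half - inverse t0_half"


section \<open>Tensor powers and the R-matrix representation\<close>

text \<open>
  The tensor power \<open>W\<^sup>\<otimes>\<^sup>n\<close> has as basis the words \<open>[i\<^sub>1, \<dots>, i\<^sub>n]\<close> over \<open>{1, 2, 3, 4}\<close>, standing for
  \<open>e\<^sub>i\<^sub>1 \<otimes> \<cdots> \<otimes> e\<^sub>i\<^sub>n\<close>.
\<close>

definition tensor_basis :: "nat \<Rightarrow> nat list set"
  where "tensor_basis n = {w. length w = n \<and> set w \<subseteq> {1..4}}"

definition tensor_power :: "nat \<Rightarrow> (nat list \<Rightarrow> ratfun) set"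
  where "tensor_power n = free_space (tensor_basis n)"

text \<open>\<open>x \<otimes> y\<close> for \<open>x \<in> W\<^sup>\<otimes>\<^sup>p\<close> and \<open>y \<in> W\<^sup>\<otimes>\<^sup>q\<close>, and \<open>A \<otimes> B\<close> for endomorphisms of these spaces.\<close>

definition tensor_vec :: "nat \<Rightarrow> (nat list \<Rightarrow> ratfun) \<Rightarrow> (nat list \<Rightarrow> ratfun) \<Rightarrow> nat list \<Rightarrow> ratfun"
  where "tensor_vec p x y = (\<lambda>w. x (take p w) * y (drop p w))"

definition tensor_map :: "nat \<Rightarrow> nat \<Rightarrow>
    ((nat list \<Rightarrow> ratfun) \<Rightarrow> nat list \<Rightarrow> ratfun) \<Rightarrow> ((nat list \<Rightarrow> ratfun) \<Rightarrow> nat list \<Rightarrow> ratfun) \<Rightarrow>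
    (nat list \<Rightarrow> ratfun) \<Rightarrow> nat list \<Rightarrow> ratfun"
  where "tensor_map p q A B =
    lin_ext (tensor_basis (p + q))
      (\<lambda>w. tensor_vec p (A (bvec (take p w))) (B (bvec (drop p w))))"

lemma tensor_vec_bvec:
  assumes "length u = p"
  shows "tensor_vec p (bvec u) (bvec v) = bvec (u @ v)"
proof -
  have "w = u @ v \<longleftrightarrow> take p w = u \<and> drop p w = v" for w
    using assms by (metis append_eq_conv_conj)
  then show ?thesis
    by (simp add: tensor_vec_def bvec_def fun_eq_iff)
qed

abbreviation e2 :: "nat \<Rightarrow> nat \<Rightarrow> nat list \<Rightarrow> ratfun"
  where "e2 i j \<equiv> bvec [i, j]"

definition R_basis :: "nat \<times> nat \<Rightarrow> nat list \<Rightarrow> ratfun"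
  where "R_basis p =
   (if p = (1,1) then (- t0) \<cdot>\<^sub>v e2 1 1
    else if p = (4,4) then (- inverse t0) \<cdot>\<^sub>v e2 4 4
    else if p = (2,2) then e2 2 2
    else if p = (3,3) then e2 3 3
    else if p = (1,2) then (- t0_half) \<cdot>\<^sub>v e2 2 1
    else if p = (2,1) then (- t0_half) \<cdot>\<^sub>v e2 1 2 + (1 - t0) \<cdot>\<^sub>v e2 2 1
    else if p = (1,3) then (- t0_half) \<cdot>\<^sub>v e2 3 1
    else if p = (3,1) then (- t0_half) \<cdot>\<^sub>v e2 1 3 + (1 - t0) \<cdot>\<^sub>v e2 3 1
    else if p = (3,4) then inverse t0_half \<cdot>\<^sub>v e2 4 3
    else if p = (4,3) then inverse t0_half \<cdot>\<^sub>v e2 3 4 + (1 - inverse t0) \<cdot>\<^sub>v e2 4 3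
    else if p = (2,4) then inverse t0_half \<cdot>\<^sub>v e2 4 2
    else if p = (4,2) then inverse t0_half \<cdot>\<^sub>v e2 2 4 + (1 - inverse t0) \<cdot>\<^sub>v e2 4 2
    else if p = (1,4) then - e2 4 1
    else if p = (2,3) then - e2 3 2 - Y \<cdot>\<^sub>v e2 4 1
    else if p = (3,2) then - e2 2 3 - Y \<cdot>\<^sub>v e2 4 1
    else if p = (4,1) then - e2 1 4 - Y \<cdot>\<^sub>v e2 2 3 - Y \<cdot>\<^sub>v e2 3 2 - (Y ^ 2) \<cdot>\<^sub>v e2 4 1
    else 0)"

definition R_map :: "(nat list \<Rightarrow> ratfun) \<Rightarrow> nat list \<Rightarrow> ratfun"
  where "R_map = lin_ext (tensor_basis 2) (\<lambda>w. R_basis (w ! 0, w ! 1))"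

definition R_gen :: "nat \<Rightarrow> nat \<Rightarrow> (nat list \<Rightarrow> ratfun) \<Rightarrow> nat list \<Rightarrow> ratfun"
  where "R_gen n i =
    restrict (tensor_map (i + 1) (n - i - 1) (tensor_map (i - 1) 2 id R_map) id) (tensor_power n)"

definition b_R :: "nat \<Rightarrow> braid_word set \<Rightarrow> (nat list \<Rightarrow> ratfun) \<Rightarrow> nat list \<Rightarrow> ratfun"
  where "b_R n = braid_lift n (GL (tensor_power n)) (R_gen n)"


section \<open>The exterior algebra\<close>

text \<open>
  The exterior algebra of the vector space with (finite, linearly ordered) basis \<open>X\<close> has a basis
  indexed by the subsets \<open>S\<close> of \<open>X\<close>: the set \<open>S\<close> stands for the wedge product of its elements in
  increasing order.  Hence for disjoint \<open>A\<close> and \<open>B\<close> the product of the corresponding basis elements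
  is the one of \<open>A \<union> B\<close>, with the sign of the permutation that sorts \<open>A\<close> followed by \<open>B\<close>.
\<close>

definition ext_space :: "'x set \<Rightarrow> ('x set \<Rightarrow> 'k::field) set"
  where "ext_space X = free_space (Pow X)"

definition shuffle_sign :: "'x::linorder set \<Rightarrow> 'x set \<Rightarrow> 'k::field"
  where "shuffle_sign A B = (-1) ^ card {(a, b). a \<in> A \<and> b \<in> B \<and> b < a}"

definition wedge :: "('x::linorder set \<Rightarrow> 'k::field) \<Rightarrow> ('x set \<Rightarrow> 'k) \<Rightarrow> 'x set \<Rightarrow> 'k"
    (infixr \<open>\<and>\<^sub>e\<close> 70)
  where "x \<and>\<^sub>e y = (\<lambda>S. \<Sum>A\<in>Pow S. shuffle_sign A (S - A) * x A * y (S - A))"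

definition wedge_list :: "('x::linorder set \<Rightarrow> 'k::field) list \<Rightarrow> 'x set \<Rightarrow> 'k"
  where "wedge_list xs = foldr (\<and>\<^sub>e) xs (bvec {})"

text \<open>The inclusion of the underlying vector space, and the algebra map induced by a linear map.\<close>

definition ext_incl :: "'x set \<Rightarrow> ('x \<Rightarrow> 'k::field) \<Rightarrow> 'x set \<Rightarrow> 'k"
  where "ext_incl X = lin_ext X (\<lambda>x. bvec {x})"

definition ext_map ::
    "'x::linorder set \<Rightarrow> (('x \<Rightarrow> 'k::field) \<Rightarrow> 'x \<Rightarrow> 'k) \<Rightarrow> ('x set \<Rightarrow> 'k) \<Rightarrow> 'x set \<Rightarrow> 'k"
  where "ext_map X T =
    lin_ext (Pow X) (\<lambda>S. wedge_list (map (\<lambda>x. ext_incl X (T (bvec x))) (sorted_list_of_set S)))"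


text \<open>
  The lemmas \<open>wedge_one\<close>, \<open>wedge_assoc\<close>, \<open>wedge_square\<close> and \<open>bvec_eq_wedge_list\<close> below say that this
  is an associative unital algebra in which the elements of the underlying space square to zero,
  and that its basis is as described above.
\<close>

lemma ext_incl_apply:
  assumes "finite X"
  shows "ext_incl X v S = (if \<exists>x\<in>X. S = {x} then v (the_elem S) else 0)"
proof -
  have app: "(\<Sum>x\<in>A. h x) S = (\<Sum>x\<in>A. h x S)" for A and h :: "'a \<Rightarrow> 'a set \<Rightarrow> 'b"
    by (induction A rule: infinite_finite_induct) auto
  have "ext_incl X v S = (\<Sum>x\<in>X. if S = {x} then v x else 0)"
    unfolding ext_incl_def lin_ext_def app
    by (rule sum.cong) (auto simp: smul_def bvec_def)
  also have "\<dots> = (if \<exists>x\<in>X. S = {x} then v (the_elem S) else 0)"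
  proof (cases "\<exists>x\<in>X. S = {x}")
    case True
    then obtain y where y: "y \<in> X" "S = {y}" by blast
    then have "(\<Sum>x\<in>X. if S = {x} then v x else 0) = (\<Sum>x\<in>X. if x = y then v x else 0)"
      by (intro sum.cong) auto
    then show ?thesis using assms y by simp
  next
    case False
    then have "(\<Sum>x\<in>X. if S = {x} then v x else 0) = 0"
      by (intro sum.neutral) auto
    then show ?thesis using False by simp
  qed
  finally show ?thesis .
qed

lemma ext_incl_bvec: "finite X \<Longrightarrow> x \<in> X \<Longrightarrow> ext_incl X (bvec x) = bvec {x}"
  unfolding ext_incl_def by (rule lin_ext_bvec)

lemma wedge_infinite: "infinite S \<Longrightarrow> (x \<and>\<^sub>e y) S = 0"
  by (simp add: wedge_def)

lemma wedge_one:
  assumes "finite X" "x \<in> ext_space X"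
  shows "bvec {} \<and>\<^sub>e x = x" and "x \<and>\<^sub>e bvec {} = x"
proof -
  have inf: "x S = 0" if "infinite S" for S
    using that assms by (auto simp: ext_space_def free_space_def dest: finite_subset)
  show "bvec {} \<and>\<^sub>e x = x"
  proof
    fix S show "(bvec {} \<and>\<^sub>e x) S = x S"
    proof (cases "finite S")
      case True
      have "(bvec {} \<and>\<^sub>e x) S = (\<Sum>A\<in>Pow S. if A = {} then x S else 0)"
        unfolding wedge_def
        by (rule sum.cong) (auto simp: bvec_def shuffle_sign_def)
      then show ?thesis using True by simp
    qed (simp add: wedge_infinite inf)
  qed
  show "x \<and>\<^sub>e bvec {} = x"
  proof
    fix S show "(x \<and>\<^sub>e bvec {}) S = x S"
    proof (cases "finite S")
      case True
      have none: "{(a, b). a \<in> S \<and> b \<in> S \<and> b \<notin> S \<and> b < a} = {}" by blast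
      have "(x \<and>\<^sub>e bvec {}) S = (\<Sum>A\<in>Pow S. if A = S then x S else 0)"
        unfolding wedge_def
        by (rule sum.cong) (auto simp: bvec_def shuffle_sign_def none)
      then show ?thesis using True by simp
    qed (simp add: wedge_infinite inf)
  qed
qed

lemma shuffle_sign_Un_left:
  assumes "finite A" "finite B" "finite C" "A \<inter> B = {}"
  shows "shuffle_sign (A \<union> B) C = (shuffle_sign A C * shuffle_sign B C :: 'k::field)"
proof -
  have "{(a, b). a \<in> A \<union> B \<and> b \<in> C \<and> b < a} =
      {(a, b). a \<in> A \<and> b \<in> C \<and> b < a} \<union> {(a, b). a \<in> B \<and> b \<in> C \<and> b < a}" by auto
  moreover have "finite {(a, b). a \<in> A \<and> b \<in> C \<and> b < a}"
    by (rule finite_subset[of _ "A \<times> C"]) (use assms in auto)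
  moreover have "finite {(a, b). a \<in> B \<and> b \<in> C \<and> b < a}"
    by (rule finite_subset[of _ "B \<times> C"]) (use assms in auto)
  ultimately show ?thesis
    unfolding shuffle_sign_def power_add[symmetric]
    using assms(4) by (subst card_Un_disjoint[symmetric]) auto
qed

lemma shuffle_sign_Un_right:
  assumes "finite A" "finite B" "finite C" "B \<inter> C = {}"
  shows "shuffle_sign A (B \<union> C) = (shuffle_sign A B * shuffle_sign A C :: 'k::field)"
proof -
  have "{(a, b). a \<in> A \<and> b \<in> B \<union> C \<and> b < a} =
      {(a, b). a \<in> A \<and> b \<in> B \<and> b < a} \<union> {(a, b). a \<in> A \<and> b \<in> C \<and> b < a}" by auto
  moreover have "finite {(a, b). a \<in> A \<and> b \<in> B \<and> b < a}"
    by (rule finite_subset[of _ "A \<times> B"]) (use assms in auto)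
  moreover have "finite {(a, b). a \<in> A \<and> b \<in> C \<and> b < a}"
    by (rule finite_subset[of _ "A \<times> C"]) (use assms in auto)
  ultimately show ?thesis
    unfolding shuffle_sign_def power_add[symmetric]
    using assms(4) by (subst card_Un_disjoint[symmetric]) auto
qed

lemma wedge_assoc:
  fixes x y z :: "'x::linorder set \<Rightarrow> 'k::field"
  shows "(x \<and>\<^sub>e y) \<and>\<^sub>e z = x \<and>\<^sub>e (y \<and>\<^sub>e z)"
proof
  fix S
  show "((x \<and>\<^sub>e y) \<and>\<^sub>e z) S = (x \<and>\<^sub>e (y \<and>\<^sub>e z)) S"
  proof (cases "finite S")
    case S: True
    have "((x \<and>\<^sub>e y) \<and>\<^sub>e z) S = (\<Sum>A\<in>Pow S. \<Sum>B\<in>Pow A. shuffle_sign A (S - A) *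
        (shuffle_sign B (A - B) * x B * y (A - B)) * z (S - A))"
      by (simp add: wedge_def sum_distrib_left sum_distrib_right)
    also have "\<dots> = (\<Sum>(A, B)\<in>Sigma (Pow S) Pow. shuffle_sign A (S - A) *
        (shuffle_sign B (A - B) * x B * y (A - B)) * z (S - A))"
      using S by (subst sum.Sigma) (auto intro: finite_subset)
    also have "\<dots> = (\<Sum>(B, C)\<in>Sigma (Pow S) (\<lambda>B. Pow (S - B)). shuffle_sign B (S - B) * x B *
        (shuffle_sign C (S - B - C) * y C * z (S - B - C)))"
    proof (rule sum.reindex_bij_witness[where i = "\<lambda>(B, C). (B \<union> C, B)" and j = "\<lambda>(A, B). (B, A - B)"],
        goal_cases)
      case (5 a)
      obtain A B where a: "a = (A, B)" by force
      with 5 have AB: "A \<subseteq> S" "B \<subseteq> A" by auto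
      define C where "C = A - B"
      define D where "D = S - A"
      have fin: "finite B" "finite C" "finite D"
        using S AB by (auto simp: C_def D_def intro: finite_subset)
      have eq: "A = B \<union> C" "S - A = D" "S - B = C \<union> D" "S - B - C = D" "A - B = C"
        and disj: "B \<inter> C = {}" "C \<inter> D = {}"
        using AB by (auto simp: C_def D_def)
      have "shuffle_sign (B \<union> C) D * shuffle_sign B C =
          (shuffle_sign B (C \<union> D) * shuffle_sign C D :: 'k)"
        using fin disj by (simp add: shuffle_sign_Un_left shuffle_sign_Un_right)
      then have sign: "shuffle_sign B (S - B) * shuffle_sign (A - B) (S - B - (A - B)) =
          (shuffle_sign A (S - A) * shuffle_sign B (A - B) :: 'k)"
        using eq by (metis mult.commute)
      have "S - B - (A - B) = S - A" using AB by auto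
      then show ?case
        using arg_cong[OF sign, of "\<lambda>c. c * (x B * y (A - B) * z (S - A))"] a
        by (simp add: mult_ac)
    qed auto
    also have "\<dots> = (\<Sum>B\<in>Pow S. \<Sum>C\<in>Pow (S - B). shuffle_sign B (S - B) * x B *
        (shuffle_sign C (S - B - C) * y C * z (S - B - C)))"
      using S by (subst sum.Sigma) (auto intro: finite_subset)
    also have "\<dots> = (x \<and>\<^sub>e (y \<and>\<^sub>e z)) S"
      by (simp add: wedge_def sum_distrib_left)
    finally show ?thesis .
  qed (simp add: wedge_infinite)
qed

lemma wedge_square:
  fixes v :: "'x::linorder \<Rightarrow> 'k::field"
  assumes "finite X"
  shows "ext_incl X v \<and>\<^sub>e ext_incl X v = 0"
proof
  fix S
  show "(ext_incl X v \<and>\<^sub>e ext_incl X v) S = 0 S"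
  proof (cases "\<exists>a b. a < b \<and> S = {a, b}")
    case True
    then obtain a b where ab: "a < b" "S = {a, b}" by blast
    have P: "Pow {a, b} = {{}, {a}, {b}, {a, b}}" by blast
    have d: "{a, b} - {a} = {b}" "{a, b} - {b} = {a}" "{a} \<noteq> {a, b}" "{b} \<noteq> {a, b}" "{a} \<noteq> {b}"
      using ab by auto
    have "{(x, y). x \<in> {a} \<and> y \<in> {b} \<and> y < x} = {}"
      "{(x, y). x \<in> {b} \<and> y \<in> {a} \<and> y < x} = {(b, a)}"
      using ab by auto
    then have "shuffle_sign {a} {b} = (1 :: 'k)" "shuffle_sign {b} {a} = (-1 :: 'k)"
      unfolding shuffle_sign_def by (simp_all only:) simp_all
    then show ?thesis
      using ab d by (simp add: wedge_def P ext_incl_apply[OF assms])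
  next
    case False
    have "ext_incl X v A * ext_incl X v (S - A) = 0" if A: "A \<subseteq> S" for A
    proof (rule ccontr)
      assume "\<not> ?thesis"
      then obtain a b where ab: "A = {a}" "S - A = {b}"
        by (auto simp: ext_incl_apply[OF assms] split: if_splits)
      then have "S = {a, b}" "a \<noteq> b" using A by auto
      then show False using False by (metis insert_commute linorder_neqE)
    qed
    then have "(ext_incl X v \<and>\<^sub>e ext_incl X v) S = (\<Sum>A\<in>Pow S. 0)"
      unfolding wedge_def by (intro sum.cong) (auto simp: mult.assoc)
    then show ?thesis by simp
  qed
qed

lemma wedge_bvec:
  assumes "finite A" "finite B" "A \<inter> B = {}"
  shows "bvec A \<and>\<^sub>e bvec B = shuffle_sign A B \<cdot>\<^sub>v bvec (A \<union> B)"
proof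
  fix S
  show "(bvec A \<and>\<^sub>e bvec B) S = (shuffle_sign A B \<cdot>\<^sub>v bvec (A \<union> B)) S"
  proof (cases "finite S")
    case True
    have "(bvec A \<and>\<^sub>e bvec B) S =
        (\<Sum>C\<in>Pow S. if C = A then if S = A \<union> B then shuffle_sign A B else 0 else 0)"
      unfolding wedge_def
      by (rule sum.cong) (use assms in \<open>auto simp: bvec_def\<close>)
    also have "\<dots> = (shuffle_sign A B \<cdot>\<^sub>v bvec (A \<union> B)) S"
      using True by (auto simp: smul_def bvec_def)
    finally show ?thesis .
  next
    case False
    then show ?thesis using assms by (auto simp: wedge_infinite smul_def bvec_def)
  qed
qed

lemma bvec_eq_wedge_list:
  fixes X :: "'x::linorder set"
  assumes "finite X" "S \<subseteq> X"
  shows "(bvec S :: 'x set \<Rightarrow> 'k::field) = wedge_list (map (\<lambda>x. ext_incl X (bvec x)) (sorted_list_of_set S))"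
proof -
  have "wedge_list (map (\<lambda>x. ext_incl X (bvec x)) xs) = (bvec (set xs) :: 'x set \<Rightarrow> 'k)"
    if "sorted xs" "distinct xs" "set xs \<subseteq> X" for xs
    using that
  proof (induction xs)
    case (Cons x xs)
    have "{(a, b). a \<in> {x} \<and> b \<in> set xs \<and> b < a} = {}" using Cons.prems by force
    then have "shuffle_sign {x} (set xs) = (1 :: 'k)"
      unfolding shuffle_sign_def by (simp only:) simp
    then have "bvec {x} \<and>\<^sub>e bvec (set xs) = (bvec (set (x # xs)) :: 'x set \<Rightarrow> 'k)"
      using Cons.prems by (simp add: wedge_bvec) (simp add: smul_def)
    then show ?case
      using Cons assms(1) by (simp add: wedge_list_def ext_incl_bvec)
  qed (simp add: wedge_list_def)
  from this[of "sorted_list_of_set S"] show ?thesis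
    using assms finite_subset by (metis distinct_sorted_list_of_set set_sorted_list_of_set
        sorted_sorted_list_of_set)
qed


section \<open>The exterior representation\<close>

text \<open>
  The two copies of \<open>W\<^sub>n\<close> both have basis \<open>{1..n}\<close>; in the disjoint sum, \<open>Inl k\<close> stands for \<open>f\<^sub>k\<close>
  and \<open>Inr k\<close> for \<open>g\<^sub>k\<close>, ordered as \<open>f\<^sub>1 < \<dots> < f\<^sub>n < g\<^sub>1 < \<dots> < g\<^sub>n\<close>.
\<close>

instantiation sum :: (linorder, linorder) linorder
begin

definition less_eq_sum :: "'a + 'b \<Rightarrow> 'a + 'b \<Rightarrow> bool"
  where "less_eq_sum x y =
    (case x of Inl a \<Rightarrow> (case y of Inl b \<Rightarrow> a \<le> b | Inr _ \<Rightarrow> True)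
             | Inr a \<Rightarrow> (case y of Inl _ \<Rightarrow> False | Inr b \<Rightarrow> a \<le> b))"

definition less_sum :: "'a + 'b \<Rightarrow> 'a + 'b \<Rightarrow> bool"
  where "less_sum x y \<longleftrightarrow> x \<le> y \<and> \<not> y \<le> x"

instance
  by intro_classes (auto simp: less_eq_sum_def less_sum_def split: sum.splits)

end

definition W_space :: "nat \<Rightarrow> (nat \<Rightarrow> ratfun) set"
  where "W_space n = free_space {1..n}"

definition F_gen :: "nat \<Rightarrow> nat \<Rightarrow> (nat \<Rightarrow> ratfun) \<Rightarrow> nat \<Rightarrow> ratfun"
  where "F_gen n i = restrict (lin_ext {1..n} (\<lambda>j.
    if j = i then (1 - inverse t0) \<cdot>\<^sub>v bvec i + inverse t0_half \<cdot>\<^sub>v bvec (i + 1)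
    else if j = i + 1 then inverse t0_half \<cdot>\<^sub>v bvec i
    else bvec j)) (W_space n)"

definition G_gen :: "nat \<Rightarrow> nat \<Rightarrow> (nat \<Rightarrow> ratfun) \<Rightarrow> nat \<Rightarrow> ratfun"
  where "G_gen n i = restrict (lin_ext {1..n} (\<lambda>j.
    if j = i then (- t0_half) \<cdot>\<^sub>v bvec (i + 1)
    else if j = i + 1 then (- t0_half) \<cdot>\<^sub>v bvec i + (1 - t0) \<cdot>\<^sub>v bvec (i + 1)
    else bvec j)) (W_space n)"

definition F_rep :: "nat \<Rightarrow> braid_word set \<Rightarrow> (nat \<Rightarrow> ratfun) \<Rightarrow> nat \<Rightarrow> ratfun"
  where "F_rep n = braid_lift n (GL (W_space n)) (F_gen n)"

definition G_rep :: "nat \<Rightarrow> braid_word set \<Rightarrow> (nat \<Rightarrow> ratfun) \<Rightarrow> nat \<Rightarrow> ratfun"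
  where "G_rep n = braid_lift n (GL (W_space n)) (G_gen n)"

definition direct_sum_map ::
    "(('x \<Rightarrow> 'k) \<Rightarrow> 'x \<Rightarrow> 'k) \<Rightarrow> (('y \<Rightarrow> 'k) \<Rightarrow> 'y \<Rightarrow> 'k) \<Rightarrow> ('x + 'y \<Rightarrow> 'k) \<Rightarrow> 'x + 'y \<Rightarrow> 'k"
  where "direct_sum_map S T v = case_sum (S (v \<circ> Inl)) (T (v \<circ> Inr))"

definition FG_basis :: "nat \<Rightarrow> (nat + nat) set"
  where "FG_basis n = {1..n} <+> {1..n}"

definition FG_ext :: "nat \<Rightarrow> ((nat + nat) set \<Rightarrow> ratfun) set"
  where "FG_ext n = ext_space (FG_basis n)"

definition Psi ::
    "nat \<Rightarrow> braid_word set \<Rightarrow> ((nat + nat) set \<Rightarrow> ratfun) \<Rightarrow> (nat + nat) set \<Rightarrow> ratfun"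
  where "Psi n = (\<lambda>b\<in>carrier (braid_group n).
    restrict (ext_map (FG_basis n) (direct_sum_map (F_rep n b) (G_rep n b))) (FG_ext n))"


section \<open>The comparison map\<close>

definition f_ext :: "nat \<Rightarrow> nat \<Rightarrow> (nat + nat) set \<Rightarrow> ratfun"
  where "f_ext n k = ext_incl (FG_basis n) (bvec (Inl k))"

definition g_ext :: "nat \<Rightarrow> nat \<Rightarrow> (nat + nat) set \<Rightarrow> ratfun"
  where "g_ext n k = ext_incl (FG_basis n) (bvec (Inr k))"

text \<open>The letter \<open>i\<^sub>k\<close> of a word \<open>w\<close> is \<open>w ! (k - 1)\<close>.\<close>

definition I_map :: "nat \<Rightarrow> (nat list \<Rightarrow> ratfun) \<Rightarrow> (nat + nat) set \<Rightarrow> ratfun"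
  where "I_map n = lin_ext (tensor_basis n) (\<lambda>w.
    wedge_list (map (f_ext n) (filter (\<lambda>k. w ! (k - 1) \<in> {3, 4}) [1..<n + 1]))
    \<and>\<^sub>e wedge_list (map (g_ext n) (filter (\<lambda>k. w ! (k - 1) \<in> {1, 3}) [1..<n + 1])))"

end

theory Submission
  imports Defs
begin

text \<open>
  Each letter \<open>1, 2, 3, 4\<close> records whether \<open>g\<^sub>k\<close>, nothing, both \<open>f\<^sub>k\<close> and \<open>g\<^sub>k\<close>, or \<open>f\<^sub>k\<close> occurs
  at position \<open>k\<close>.  Words are therefore the same as subsets of the basis of \<open>W\<^sub>n \<oplus> W\<^sub>n\<close>, and \<open>I\<^sub>n\<close>
  carries the word basis bijectively onto the monomial basis of the exterior algebra, with no
  sign at all, because \<open>I\<^sub>n\<close> lists the factors in increasing order (\<open>bij_betw_I_map\<close>).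

  For the intertwining property, write a word as \<open>u a b v\<close> with \<open>a, b\<close> at positions \<open>i, i + 1\<close>.
  Its image is \<open>P \<and> x \<and> Q \<and> y \<and> S\<close>, where \<open>x\<close> is a monomial in \<open>f\<^sub>i, f\<^sub>i\<^sub>+\<^sub>1\<close>, \<open>y\<close> a monomial in
  \<open>g\<^sub>i, g\<^sub>i\<^sub>+\<^sub>1\<close>, and \<open>P, Q, S\<close> come from \<open>u, v\<close> only.  The algebra map induced by a linear map is multiplicative, so
  \<open>\<sigma>\<^sub>i\<close> fixes \<open>P, Q, S\<close> and acts on \<open>x\<close> and \<open>y\<close> through 2-by-2 matrices.  The expression is bilinear
  in \<open>(x, y)\<close>, hence no reordering across \<open>Q\<close> ever takes place, and the claim
  becomes the comparison of sixteen pairs \<open>(a, b)\<close> with the entries of the R-matrix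
  (\<open>I_map_R_gen_bvec\<close>).

  That \<open>\<Psi>\<^sub>n\<close> is a representation is checked on the two Burau-type representations \<open>F\<close> and \<open>G\<close>,
  where the braid relation is an identity between 3-by-3 matrices (\<open>braid_images_block_op\<close>), and
  transported by the functors direct sum (\<open>direct_sum_hom_GL\<close>) and exterior algebra
  (\<open>ext_map_hom\<close>).  The braid relations for \<open>R\<close> are then inherited from \<open>\<Psi>\<^sub>n\<close>: conjugating
  \<open>\<Psi>\<^sub>n\<close> by the bijection \<open>I\<^sub>n\<close> gives a representation on the tensor power
  (\<open>conjugate_hom_GL\<close>) that sends \<open>\<sigma>\<^sub>i\<close> to the R-matrix operator, so these operators satisfy the
  braid relations, and by uniqueness this representation is \<open>b\<^sub>R\<^sup>n\<close>.
\<close>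


section \<open>Linear maps on free spaces\<close>

lemma sum_fun_apply: "(\<Sum>x\<in>A. f x) y = (\<Sum>x\<in>A. f x y)"
  by (induction A rule: infinite_finite_induct) auto

lemma smul_apply: "(c \<cdot>\<^sub>v v) x = c * v x"
  by (simp add: smul_def)

lemma lin_ext_apply: "lin_ext X \<phi> v y = (\<Sum>x\<in>X. v x * \<phi> x y)"
  by (simp add: lin_ext_def sum_fun_apply smul_def)

lemma lin_ext_cong:
  "(\<And>x. x \<in> X \<Longrightarrow> \<phi> x = \<psi> x) \<Longrightarrow> lin_ext X \<phi> v = lin_ext X \<psi> v"
  by (simp add: lin_ext_def)

lemma bvec_in_free_space: "x \<in> X \<Longrightarrow> bvec x \<in> free_space X"
  by (auto simp: free_space_def bvec_def)

lemma free_space_zero: "0 \<in> free_space X"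
  by (simp add: free_space_def)

lemma free_space_sum:
  "(\<And>x. x \<in> A \<Longrightarrow> f x \<in> free_space X) \<Longrightarrow> (\<Sum>x\<in>A. f x) \<in> free_space X"
  by (auto simp: free_space_def sum_fun_apply intro: sum.neutral)

lemma lin_ext_in_free_space:
  "(\<And>x. x \<in> X \<Longrightarrow> \<phi> x \<in> free_space Z) \<Longrightarrow> lin_ext X \<phi> v \<in> free_space Z"
  unfolding lin_ext_def by (intro free_space_sum free_space_smul)

lemma linear_on_add: "linear_on V T \<Longrightarrow> u \<in> V \<Longrightarrow> v \<in> V \<Longrightarrow> T (u + v) = T u + T v"
  by (simp add: linear_on_def)

lemma linear_on_smul: "linear_on V T \<Longrightarrow> v \<in> V \<Longrightarrow> T (c \<cdot>\<^sub>v v) = c \<cdot>\<^sub>v T v"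
  by (simp add: linear_on_def)

lemma linear_on_zero:
  assumes "linear_on (free_space X) T"
  shows "T 0 = 0"
proof -
  have "T (0 \<cdot>\<^sub>v 0) = 0 \<cdot>\<^sub>v T 0"
    using assms by (rule linear_on_smul) (rule free_space_zero)
  then show ?thesis by (simp add: smul_def fun_eq_iff zero_fun_def)
qed

lemma linear_on_sum:
  assumes "linear_on (free_space X) T" "\<And>x. x \<in> A \<Longrightarrow> f x \<in> free_space X"
  shows "T (\<Sum>x\<in>A. f x) = (\<Sum>x\<in>A. T (f x))"
  using assms(2)
proof (induction A rule: infinite_finite_induct)
  case (insert x A)
  then have "T (f x + (\<Sum>x\<in>A. f x)) = T (f x) + (\<Sum>x\<in>A. T (f x))"
    by (subst linear_on_add[OF assms(1)]) (auto intro: free_space_sum)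
  then show ?case
    using insert.hyps by (simp only: sum.insert not_False_eq_True)
qed (simp_all add: linear_on_zero[OF assms(1)])

lemma linear_on_UNIV_uminus: "linear_on UNIV T \<Longrightarrow> T (- v) = - T v"
  using linear_on_smul[of UNIV T v "-1"] by (simp add: smul_def fun_Compl_def)

lemma linear_on_UNIV_diff: "linear_on UNIV T \<Longrightarrow> T (u - v) = T u - T v"
  using linear_on_add[of UNIV T u "- v"] by (simp add: linear_on_UNIV_uminus fun_eq_iff)

lemma linear_on_subset: "linear_on V T \<Longrightarrow> U \<subseteq> V \<Longrightarrow> linear_on U T"
  unfolding linear_on_def by blast

lemma linear_on_comp:
  "linear_on V T \<Longrightarrow> T ` V \<subseteq> U \<Longrightarrow> linear_on U S \<Longrightarrow> linear_on V (\<lambda>v. S (T v))"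
  unfolding linear_on_def by (auto simp: image_subset_iff)

lemma linear_on_restrict:
  "linear_on (free_space X) (restrict T (free_space X)) \<longleftrightarrow> linear_on (free_space X) T"
  by (simp add: linear_on_def free_space_add free_space_smul)

lemma lin_ext_bvec_id:
  assumes "finite X" "v \<in> free_space X"
  shows "lin_ext X bvec v = v"
proof
  fix y
  have "lin_ext X bvec v y = (\<Sum>x\<in>X. if x = y then v y else 0)"
    unfolding lin_ext_apply by (rule sum.cong) (auto simp: bvec_def)
  then show "lin_ext X bvec v y = v y"
    using assms by (auto simp: free_space_def)
qed

lemma linear_on_eq_lin_ext:
  assumes "finite X" "linear_on (free_space X) T" "v \<in> free_space X"
  shows "T v = lin_ext X (\<lambda>x. T (bvec x)) v"
proof -
  have "T v = T (\<Sum>x\<in>X. v x \<cdot>\<^sub>v bvec x)"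
    using lin_ext_bvec_id[OF assms(1,3)] by (simp add: lin_ext_def)
  also have "\<dots> = (\<Sum>x\<in>X. T (v x \<cdot>\<^sub>v bvec x))"
    by (rule linear_on_sum[OF assms(2)]) (simp add: free_space_smul bvec_in_free_space)
  also have "\<dots> = lin_ext X (\<lambda>x. T (bvec x)) v"
    unfolding lin_ext_def
    by (rule sum.cong) (simp_all add: linear_on_smul[OF assms(2)] bvec_in_free_space)
  finally show ?thesis .
qed

lemma linear_on_eqI:
  assumes "finite X" "linear_on (free_space X) S" "linear_on (free_space X) T"
    and "\<And>x. x \<in> X \<Longrightarrow> S (bvec x) = T (bvec x)" "v \<in> free_space X"
  shows "S v = T v"
  using assms by (simp add: linear_on_eq_lin_ext[of X S] linear_on_eq_lin_ext[of X T] cong: lin_ext_cong)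

lemma linear_lin_ext:
  "lin_ext X \<phi> (u + v) = lin_ext X \<phi> u + lin_ext X \<phi> v"
  "lin_ext X \<phi> (c \<cdot>\<^sub>v v) = c \<cdot>\<^sub>v lin_ext X \<phi> v"
  using linear_on_lin_ext[of UNIV X \<phi>] by (simp_all add: linear_on_def)

lemma bij_betw_lin_ext_bvec:
  assumes X: "finite X" and \<phi>: "bij_betw \<phi> X Z"
  shows "bij_betw (lin_ext X (\<lambda>x. bvec (\<phi> x))) (free_space X) (free_space Z)"
proof -
  have Z: "finite Z" using assms bij_betw_finite by blast
  let ?S = "lin_ext X (\<lambda>x. bvec (\<phi> x))"
  let ?T = "lin_ext Z (\<lambda>z. bvec (inv_into X \<phi> z))"
  have \<phi>x: "\<phi> x \<in> Z" "inv_into X \<phi> (\<phi> x) = x" if "x \<in> X" for x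
    using \<phi> that by (auto simp: bij_betw_def)
  have \<phi>z: "inv_into X \<phi> z \<in> X" "\<phi> (inv_into X \<phi> z) = z" if "z \<in> Z" for z
    using \<phi> that by (auto simp: bij_betw_def inv_into_into f_inv_into_f)
  have "?T (?S v) = v" if "v \<in> free_space X" for v
    by (rule linear_on_eqI[where S = "\<lambda>v. ?T (?S v)" and T = "\<lambda>v. v", OF X _ _ _ that])
      (simp_all add: linear_on_def linear_lin_ext lin_ext_bvec X Z \<phi>x)
  moreover have "?S (?T v) = v" if "v \<in> free_space Z" for v
    by (rule linear_on_eqI[where S = "\<lambda>v. ?S (?T v)" and T = "\<lambda>v. v", OF Z _ _ _ that])
      (simp_all add: linear_on_def linear_lin_ext lin_ext_bvec X Z \<phi>z)
  ultimately show ?thesis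
    by (intro bij_betw_byWitness[where f' = ?T])
      (auto intro!: lin_ext_in_free_space bvec_in_free_space \<phi>x \<phi>z)
qed

section \<open>Linear automorphism groups\<close>

lemma GL_mult: "S \<in> carrier (GL V) \<Longrightarrow> T \<in> carrier (GL V) \<Longrightarrow> S \<otimes>\<^bsub>GL V\<^esub> T = compose V S T"
  by (simp add: GL_def BijGroup_def)

lemma GL_carrier: "T \<in> carrier (GL V) \<longleftrightarrow> T \<in> extensional V \<and> bij_betw T V V \<and> linear_on V T"
  by (simp add: GL_def Bij_def)

lemma GL_closed: "T \<in> carrier (GL V) \<Longrightarrow> v \<in> V \<Longrightarrow> T v \<in> V"
  by (auto simp: GL_carrier bij_betw_def)

lemma GL_one: "\<one>\<^bsub>GL V\<^esub> = (\<lambda>v\<in>V. v)"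
  by (simp add: GL_def BijGroup_def)

lemma GL_I:
  assumes "T \<in> extensional V" "linear_on V T" "\<And>v. v \<in> V \<Longrightarrow> T v \<in> V"
    and "\<And>v. v \<in> V \<Longrightarrow> S v \<in> V" "\<And>v. v \<in> V \<Longrightarrow> S (T v) = v" "\<And>v. v \<in> V \<Longrightarrow> T (S v) = v"
  shows "T \<in> carrier (GL V)"
  unfolding GL_carrier using assms by (auto intro!: bij_betw_byWitness[where f' = S])

lemma GL_mult_restrict:
  assumes "restrict S V \<in> carrier (GL V)" "restrict T V \<in> carrier (GL V)"
  shows "restrict S V \<otimes>\<^bsub>GL V\<^esub> restrict T V = restrict (\<lambda>v. S (T v)) V"
proof -
  have "T v \<in> V" if "v \<in> V" for v
    using GL_closed[OF assms(2) that] that by simp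
  then show ?thesis
    unfolding GL_mult[OF assms] by (auto simp: compose_def fun_eq_iff)
qed

text \<open>
  Invertibility is automatic for a multiplicative family indexed by a group: the inverse of
  \<open>L b\<close> is the operator of the inverse of \<open>b\<close>.  It serves for every homomorphism below that is not
  given on generators.
\<close>

lemma hom_GL_I:
  fixes L :: "'g \<Rightarrow> ('x \<Rightarrow> 'k::field) \<Rightarrow> 'x \<Rightarrow> 'k"
  assumes "group B"
    and lin: "\<And>b. b \<in> carrier B \<Longrightarrow> linear_on (free_space X) (L b)"
    and closed: "\<And>b v. b \<in> carrier B \<Longrightarrow> v \<in> free_space X \<Longrightarrow> L b v \<in> free_space X"
    and one: "\<And>v. v \<in> free_space X \<Longrightarrow> L \<one>\<^bsub>B\<^esub> v = v"
    and mult: "\<And>a b v. a \<in> carrier B \<Longrightarrow> b \<in> carrier B \<Longrightarrow> v \<in> free_space X \<Longrightarrow>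
      L (a \<otimes>\<^bsub>B\<^esub> b) v = L a (L b v)"
  shows "(\<lambda>b. restrict (L b) (free_space X)) \<in> hom B (GL (free_space X))"
proof (rule homI)
  interpret group B by fact
  show *: "restrict (L b) (free_space X) \<in> carrier (GL (free_space X))"
    if b: "b \<in> carrier B" for b
  proof -
    have "L (inv\<^bsub>B\<^esub> b) (L b v) = v" "L b (L (inv\<^bsub>B\<^esub> b) v) = v" if "v \<in> free_space X" for v
      using b that by (simp_all flip: mult add: one)
    then show ?thesis
      using b by (intro GL_I[where S = "L (inv\<^bsub>B\<^esub> b)"]) (auto simp: closed linear_on_restrict lin)
  qed
  fix a b
  assume ab: "a \<in> carrier B" "b \<in> carrier B"
  show "restrict (L (a \<otimes>\<^bsub>B\<^esub> b)) (free_space X) =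
      restrict (L a) (free_space X) \<otimes>\<^bsub>GL (free_space X)\<^esub> restrict (L b) (free_space X)"
    unfolding GL_mult[OF * *, OF ab]
    by (rule ext) (simp add: mult[OF ab] closed[OF ab(2)] compose_def)
qed

lemma conjugate_hom_GL:
  fixes I :: "('x \<Rightarrow> 'k::field) \<Rightarrow> 'y \<Rightarrow> 'k"
  assumes B: "group B" and \<rho>: "\<rho> \<in> hom B (GL (free_space Z))"
    and lin: "linear_on (free_space X) I" and bij: "bij_betw I (free_space X) (free_space Z)"
  shows "(\<lambda>b. \<lambda>v\<in>free_space X. inv_into (free_space X) I (\<rho> b (I v))) \<in> hom B (GL (free_space X))"
proof -
  let ?V = "free_space X :: ('x \<Rightarrow> 'k) set" and ?W = "free_space Z :: ('y \<Rightarrow> 'k) set"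
  let ?J = "inv_into ?V I"
  have I: "I v \<in> ?W" if "v \<in> ?V" for v
    using bij that by (auto simp: bij_betw_def)
  have J: "?J w \<in> ?V" "I (?J w) = w" if "w \<in> ?W" for w
    using bij that by (auto simp: bij_betw_def inv_into_into f_inv_into_f)
  have JI: "?J (I v) = v" if "v \<in> ?V" for v
    using bij that by (simp add: bij_betw_def)
  have \<rho>_carrier: "\<rho> b \<in> carrier (GL ?W)" if "b \<in> carrier B" for b
    using \<rho> that by (rule hom_in_carrier)
  have \<rho>_closed: "\<rho> b w \<in> ?W" if "b \<in> carrier B" "w \<in> ?W" for b w
    using GL_closed[OF \<rho>_carrier] that by blast
  have J_add: "?J (u + v) = ?J u + ?J v" if "u \<in> ?W" "v \<in> ?W" for u v
    using JI[of "?J u + ?J v"] J that linear_on_add[OF lin] by (simp add: free_space_add)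
  have J_smul: "?J (c \<cdot>\<^sub>v v) = c \<cdot>\<^sub>v ?J v" if "v \<in> ?W" for c v
    using JI[of "c \<cdot>\<^sub>v ?J v"] J that linear_on_smul[OF lin] by (simp add: free_space_smul)
  show ?thesis
  proof (rule hom_GL_I[OF B])
    fix b assume b: "b \<in> carrier B"
    have \<rho>_lin: "linear_on ?W (\<rho> b)"
      using \<rho>_carrier[OF b] by (simp add: GL_carrier)
    show "linear_on ?V (\<lambda>v. ?J (\<rho> b (I v)))"
      using lin \<rho>_lin by (simp add: linear_on_def I \<rho>_closed b J_add J_smul)
    show "?J (\<rho> b (I v)) \<in> ?V" if "v \<in> ?V" for v
      using that by (simp add: I \<rho>_closed b J)
    fix a v assume a: "a \<in> carrier B" and v: "v \<in> ?V"
    have "\<rho> (a \<otimes>\<^bsub>B\<^esub> b) = compose ?W (\<rho> a) (\<rho> b)"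
      using hom_mult[OF \<rho> a b] by (simp add: GL_mult \<rho>_carrier a b)
    then show "?J (\<rho> (a \<otimes>\<^bsub>B\<^esub> b) (I v)) = ?J (\<rho> a (I (?J (\<rho> b (I v)))))"
      using v by (simp add: compose_eq I J \<rho>_closed b)
  next
    fix v assume v: "v \<in> ?V"
    have "\<rho> \<one>\<^bsub>B\<^esub> = (\<lambda>w\<in>?W. w)"
      using hom_one[OF \<rho> B group_GL] by (simp add: GL_one)
    then show "?J (\<rho> \<one>\<^bsub>B\<^esub> (I v)) = v"
      using v by (simp add: I JI)
  qed
qed

section \<open>Homomorphisms out of the braid group\<close>

lemma braid_images_cong:
  assumes "\<And>i. i \<in> {1..<n} \<Longrightarrow> s i = t i"
  shows "braid_images n G s \<longleftrightarrow> braid_images n G t"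
  unfolding braid_images_def by (simp add: assms)

lemma braid_gen_carrier:
  assumes "i \<in> {1..<n}"
  shows "braid_gen n i \<in> carrier (braid_group n)"
  unfolding braid_gen_def carrier_braid_group
  by (rule bexI[where x = "[(i, True)]"])
    (rule HOL.refl, use assms in \<open>simp only: braid_words_Cons braid_words_Nil\<close>)

text \<open>
  The generators of the braid group satisfy the Artin relations, so the images under a
  homomorphism do too.  This is how the braid relations of the R-matrix operators are
  obtained.
\<close>

lemma braid_images_of_hom:
  assumes G: "group G" and h: "h \<in> hom (braid_group n) G"
  shows "braid_images n G (\<lambda>i. h (braid_gen n i))"
proof -
  let ?B = "braid_group n"
  interpret B: group ?B by (rule group_braid_group)
  have gen: "i \<in> {1..<n} \<Longrightarrow> braid_gen n i \<in> carrier ?B" for i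
    by (rule braid_gen_carrier)
  have comm: "braid_gen n i \<otimes>\<^bsub>?B\<^esub> braid_gen n j = braid_gen n j \<otimes>\<^bsub>?B\<^esub> braid_gen n i"
    if "i \<in> {1..<n}" "j \<in> {1..<n}" "i + 1 < j" for i j
    using that unfolding braid_gen_def
    by (simp add: braid_class_mult) (intro braid_class_eqI braid_cong.commute; simp)
  have braid: "braid_gen n i \<otimes>\<^bsub>?B\<^esub> (braid_gen n (i + 1) \<otimes>\<^bsub>?B\<^esub> braid_gen n i) =
      braid_gen n (i + 1) \<otimes>\<^bsub>?B\<^esub> (braid_gen n i \<otimes>\<^bsub>?B\<^esub> braid_gen n (i + 1))"
    if "1 \<le> i" "i + 1 < n" for i
    using that braid_class_eqI[OF _ _ braid_cong.braid[OF that]] unfolding braid_gen_def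
    by (simp add: braid_class_mult)
  show ?thesis
    unfolding braid_images_def
  proof (intro conjI ballI allI impI)
    fix i j assume "i \<in> {1..<n}" "j \<in> {1..<n}" "i + 1 < j"
    then show "h (braid_gen n i) \<otimes>\<^bsub>G\<^esub> h (braid_gen n j) = h (braid_gen n j) \<otimes>\<^bsub>G\<^esub> h (braid_gen n i)"
      using comm gen hom_mult[OF h] by metis
  next
    fix i assume "1 \<le> i \<and> i + 1 < n"
    then have i: "1 \<le> i" "i + 1 < n" "i \<in> {1..<n}" "i + 1 \<in> {1..<n}" by auto
    show "h (braid_gen n i) \<otimes>\<^bsub>G\<^esub> (h (braid_gen n (i + 1)) \<otimes>\<^bsub>G\<^esub> h (braid_gen n i)) =
        h (braid_gen n (i + 1)) \<otimes>\<^bsub>G\<^esub> (h (braid_gen n i) \<otimes>\<^bsub>G\<^esub> h (braid_gen n (i + 1)))"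
      using arg_cong[OF braid[OF i(1,2)], of h] gen[OF i(3)] gen[OF i(4)]
      by (simp only: hom_mult[OF h] B.m_closed)
  qed (use gen hom_in_carrier[OF h] in blast)
qed

section \<open>Functoriality of the exterior algebra\<close>

lemma wedge_add_left: "(x + y) \<and>\<^sub>e z = x \<and>\<^sub>e z + y \<and>\<^sub>e z"
  by (rule ext) (simp add: wedge_def sum.distrib algebra_simps)

lemma wedge_add_right: "z \<and>\<^sub>e (x + y) = z \<and>\<^sub>e x + z \<and>\<^sub>e y"
  by (rule ext) (simp add: wedge_def sum.distrib algebra_simps)

lemma wedge_smul_left: "(c \<cdot>\<^sub>v x) \<and>\<^sub>e z = c \<cdot>\<^sub>v (x \<and>\<^sub>e z)"
  by (rule ext) (simp add: wedge_def smul_def sum_distrib_left mult_ac)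

lemma wedge_smul_right: "z \<and>\<^sub>e (c \<cdot>\<^sub>v x) = c \<cdot>\<^sub>v (z \<and>\<^sub>e x)"
  by (rule ext) (simp add: wedge_def smul_def sum_distrib_left mult_ac)

lemma wedge_zero_left: "0 \<and>\<^sub>e x = 0"
  by (rule ext) (simp add: wedge_def)

lemma wedge_zero_right: "x \<and>\<^sub>e 0 = 0"
  by (rule ext) (simp add: wedge_def)

lemma wedge_uminus_left: "(- x) \<and>\<^sub>e y = - (x \<and>\<^sub>e y)"
  by (rule ext) (simp add: wedge_def sum_negf)

lemmas wedge_bilinear = wedge_add_left wedge_add_right wedge_smul_left wedge_smul_right

lemma wedge_in_ext_space:
  assumes "x \<in> ext_space X" "y \<in> ext_space X"
  shows "x \<and>\<^sub>e y \<in> ext_space X"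
proof -
  have "x A * y (S - A) = 0" if "\<not> S \<subseteq> X" "A \<subseteq> S" for A S
  proof -
    have "\<not> A \<subseteq> X \<or> \<not> S - A \<subseteq> X" using that by blast
    moreover have "x A = 0" if "\<not> A \<subseteq> X" for A
      using assms(1) that by (simp add: ext_space_def free_space_def)
    moreover have "y A = 0" if "\<not> A \<subseteq> X" for A
      using assms(2) that by (simp add: ext_space_def free_space_def)
    ultimately show ?thesis by (metis mult_eq_0_iff)
  qed
  then have "shuffle_sign A (S - A) * x A * y (S - A) = 0" if "\<not> S \<subseteq> X" "A \<subseteq> S" for A S
    using that by (metis mult.assoc mult_zero_right)
  then show ?thesis
    unfolding ext_space_def free_space_def wedge_def
    by (intro CollectI allI impI sum.neutral ballI) blast
qed

lemma bvec_in_ext_space: "S \<subseteq> X \<Longrightarrow> bvec S \<in> ext_space X"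
  by (simp add: ext_space_def bvec_in_free_space)

lemma ext_incl_in_ext_space: "ext_incl X v \<in> ext_space X"
  unfolding ext_incl_def ext_space_def
  by (intro lin_ext_in_free_space bvec_in_free_space) auto

lemma wedge_list_in_ext_space:
  "set xs \<subseteq> ext_space X \<Longrightarrow> wedge_list xs \<in> ext_space X"
  by (induction xs) (auto simp: wedge_list_def wedge_in_ext_space bvec_in_ext_space)

lemma wedge_list_Nil: "wedge_list [] = bvec {}"
  and wedge_list_Cons: "wedge_list (x # xs) = x \<and>\<^sub>e wedge_list xs"
  by (simp_all add: wedge_list_def)

lemma wedge_list_append:
  assumes "finite X" "set ys \<subseteq> ext_space X"
  shows "wedge_list (xs @ ys) = wedge_list xs \<and>\<^sub>e wedge_list ys"
  by (induction xs)
    (simp_all add: wedge_list_Nil wedge_list_Cons wedge_assoc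
      wedge_one[OF assms(1) wedge_list_in_ext_space[OF assms(2)]])

lemma wedge_anticommute:
  fixes u v :: "'x::linorder \<Rightarrow> 'k::field"
  assumes "finite X"
  shows "ext_incl X u \<and>\<^sub>e ext_incl X v = - (ext_incl X v \<and>\<^sub>e ext_incl X u)"
proof -
  \<comment> \<open>Polarization of the square-zero law.\<close>
  have "ext_incl X (u + v) \<and>\<^sub>e ext_incl X (u + v) = 0"
    by (rule wedge_square[OF assms])
  then have "ext_incl X u \<and>\<^sub>e ext_incl X v + ext_incl X v \<and>\<^sub>e ext_incl X u = 0"
    by (simp add: ext_incl_def linear_lin_ext wedge_bilinear add.commute
        wedge_square[OF assms, unfolded ext_incl_def])
  then show ?thesis by (rule eq_neg_iff_add_eq_0[THEN iffD2])
qed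

lemma wedge_bvec_overlap:
  assumes "A \<inter> B \<noteq> {}"
  shows "bvec A \<and>\<^sub>e bvec B = 0"
proof
  fix S
  have "bvec A C * bvec B (S - C) = (0 :: 'b)" for C
    using assms by (auto simp: bvec_def)
  then show "(bvec A \<and>\<^sub>e bvec B) S = (0 :: 'a set \<Rightarrow> 'b) S"
    by (simp only: wedge_def mult.assoc) simp
qed

lemma wedge_bvec_below:
  assumes "finite S" "\<And>a. a \<in> S \<Longrightarrow> m < a"
  shows "bvec {m} \<and>\<^sub>e bvec S = bvec (insert m S)"
proof -
  have "m \<notin> S" using assms(2) by blast
  moreover have "{(a, b). a \<in> {m} \<and> b \<in> S \<and> b < a} = {}"
    using assms(2) by (auto dest: less_asym)
  then have "shuffle_sign {m} S = (1 :: 'b)"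
    unfolding shuffle_sign_def by (simp only:) simp
  ultimately show ?thesis
    using assms(1) by (simp add: wedge_bvec) (simp add: smul_def)
qed

context
  fixes X :: "'x::linorder set" and T :: "('x \<Rightarrow> 'k::field) \<Rightarrow> 'x \<Rightarrow> 'k"
  assumes X: "finite X"
begin

abbreviation (input) gen_image :: "'x \<Rightarrow> 'x set \<Rightarrow> 'k"
  where "gen_image x \<equiv> ext_incl X (T (bvec x))"

lemma linear_on_ext_map: "linear_on V (ext_map X T)"
  unfolding ext_map_def by (rule linear_on_lin_ext)

lemma ext_map_closed: "ext_map X T v \<in> ext_space X"
  unfolding ext_map_def ext_space_def
  by (rule lin_ext_in_free_space, fold ext_space_def, rule wedge_list_in_ext_space)
    (auto simp: ext_incl_in_ext_space)

lemma ext_map_bvec: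
  "S \<subseteq> X \<Longrightarrow> ext_map X T (bvec S) = wedge_list (map gen_image (sorted_list_of_set S))"
  unfolding ext_map_def by (rule lin_ext_bvec) (use X in auto)

lemma ext_map_bvec_insert_below:
  assumes "insert m S \<subseteq> X" "\<And>a. a \<in> S \<Longrightarrow> m < a"
  shows "ext_map X T (bvec (insert m S)) = gen_image m \<and>\<^sub>e ext_map X T (bvec S)"
proof -
  have S: "finite S" using assms(1) X finite_subset by auto
  have m: "m \<notin> S" using assms(2) by blast
  have "sorted_list_of_set (insert m S) = insort m (sorted_list_of_set S)"
    using S m by simp
  also have "\<dots> = m # sorted_list_of_set S"
    by (rule insort_is_Cons) (use assms(2) S in \<open>auto intro: less_imp_le\<close>)
  finally show ?thesis
    using assms(1) by (simp add: ext_map_bvec wedge_list_Cons)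
qed

text \<open>
  The heart of multiplicativity.  The map \<open>ext_map X T\<close> is defined on increasing monomials only, so
  the factor \<open>x\<close> in front has to be moved to its place.  Each exchange with the smallest element
  \<open>m\<close> costs the same sign on both sides, because the images of \<open>x\<close> and \<open>m\<close> anticommute like
  \<open>x\<close> and \<open>m\<close> themselves.
\<close>

lemma ext_map_gen_wedge_bvec:
  assumes x: "x \<in> X" and "S \<subseteq> X"
  shows "ext_map X T (bvec {x} \<and>\<^sub>e bvec S) = gen_image x \<and>\<^sub>e ext_map X T (bvec S)"
proof -
  let ?E = "ext_map X T"
  have "finite S" using assms(2) X finite_subset by blast
  then show ?thesis using assms(2)
  proof (induction S rule: finite_linorder_min_induct)
    case empty
    show ?case
      using ext_map_bvec_insert_below[of x "{}"] x by (subst wedge_bvec_below) simp_all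
  next
    case (insert m S)
    have IH: "?E (bvec {x} \<and>\<^sub>e bvec S) = gen_image x \<and>\<^sub>e ?E (bvec S)"
      using insert by simp
    have Em: "?E (bvec (insert m S)) = gen_image m \<and>\<^sub>e ?E (bvec S)"
      using insert.prems insert.hyps by (intro ext_map_bvec_insert_below) auto
    consider "x < m" | "x = m" | "m < x" by fastforce
    then show ?case
    proof cases
      case 1
      then have less: "x < a" if "a \<in> insert m S" for a
        using that insert.hyps by auto
      show ?thesis
        using less insert.prems insert.hyps x
        by (subst wedge_bvec_below) (auto intro!: ext_map_bvec_insert_below)
    next
      case 2
      have "?E 0 = 0"
        using linear_on_zero[OF linear_on_ext_map] .
      then have "?E (bvec {x} \<and>\<^sub>e bvec (insert m S)) = 0"
        using 2 by (simp add: wedge_bvec_overlap)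
      moreover have "gen_image x \<and>\<^sub>e ?E (bvec (insert m S)) = 0"
        unfolding Em using 2 wedge_square[OF X, of "T (bvec m)"]
        by (simp add: wedge_zero_left flip: wedge_assoc)
      ultimately show ?thesis by simp
    next
      case 3
      let ?z = "bvec {x} \<and>\<^sub>e bvec S :: 'x set \<Rightarrow> 'k"
      \<comment> \<open>The product of \<open>x\<close> and \<open>S\<close> is zero or a multiple of a monomial lying above \<open>m\<close>.\<close>
      have Ez: "?E (bvec {m} \<and>\<^sub>e ?z) = gen_image m \<and>\<^sub>e ?E ?z"
      proof (cases "x \<in> S")
        case True
        then show ?thesis
          using linear_on_zero[OF linear_on_ext_map]
          by (simp add: wedge_bvec_overlap wedge_zero_right)
      next
        case False
        then have z: "?z = shuffle_sign {x} S \<cdot>\<^sub>v bvec (insert x S)"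
          using insert.hyps by (simp add: wedge_bvec)
        have less: "m < a" if "a \<in> insert x S" for a
          using that 3 insert.hyps by auto
        have "?E (bvec (insert m (insert x S))) = gen_image m \<and>\<^sub>e ?E (bvec (insert x S))"
          using less insert.prems x by (intro ext_map_bvec_insert_below) auto
        moreover have "bvec {m} \<and>\<^sub>e bvec (insert x S) = (bvec (insert m (insert x S)) :: 'x set \<Rightarrow> 'k)"
          using less insert.hyps by (intro wedge_bvec_below) auto
        ultimately show ?thesis
          using linear_on_ext_map[of UNIV] unfolding z
          by (simp add: wedge_smul_right linear_on_smul)
      qed
      \<comment> \<open>Exchange \<open>x\<close> with \<open>m\<close>, apply the induction hypothesis, and exchange the images back.\<close>
      have anti: "bvec {x} \<and>\<^sub>e bvec {m} = - (bvec {m} \<and>\<^sub>e bvec {x} :: 'x set \<Rightarrow> 'k)"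
        using wedge_anticommute[OF X, of "bvec x" "bvec m"] x insert.prems X
        by (simp add: ext_incl_bvec)
      have "bvec {x} \<and>\<^sub>e bvec (insert m S) = bvec {x} \<and>\<^sub>e (bvec {m} \<and>\<^sub>e bvec S)"
        using insert.hyps by (simp add: wedge_bvec_below)
      also have "\<dots> = (-1) \<cdot>\<^sub>v (bvec {m} \<and>\<^sub>e ?z)"
        by (simp add: anti wedge_uminus_left fun_eq_iff smul_def flip: wedge_assoc)
      finally have "?E (bvec {x} \<and>\<^sub>e bvec (insert m S)) = (-1) \<cdot>\<^sub>v ?E (bvec {m} \<and>\<^sub>e ?z)"
        using linear_on_ext_map[of UNIV] by (simp add: linear_on_smul)
      also have "\<dots> = (-1) \<cdot>\<^sub>v (gen_image m \<and>\<^sub>e gen_image x \<and>\<^sub>e ?E (bvec S))"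
        unfolding Ez IH ..
      also have "\<dots> = gen_image x \<and>\<^sub>e gen_image m \<and>\<^sub>e ?E (bvec S)"
        by (simp add: wedge_anticommute[OF X, of "T (bvec x)" "T (bvec m)"] wedge_uminus_left
            fun_eq_iff smul_def flip: wedge_assoc)
      finally show ?thesis unfolding Em .
    qed
  qed
qed

lemma ext_map_wedge:
  assumes T: "linear_on (free_space X) T" and v: "v \<in> free_space X" and y: "y \<in> ext_space X"
  shows "ext_map X T (ext_incl X v \<and>\<^sub>e y) = ext_incl X (T v) \<and>\<^sub>e ext_map X T y"
proof -
  have E: "ext_map X T (a + b) = ext_map X T a + ext_map X T b"
    "ext_map X T (c \<cdot>\<^sub>v a) = c \<cdot>\<^sub>v ext_map X T a" for a b c
    using linear_on_ext_map[of UNIV] by (simp_all add: linear_on_def)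
  have gen: "ext_map X T (bvec {x} \<and>\<^sub>e y) = gen_image x \<and>\<^sub>e ext_map X T y" if "x \<in> X" for x
  proof (rule linear_on_eqI[where X = "Pow X" and v = y and S = "\<lambda>y. ext_map X T (bvec {x} \<and>\<^sub>e y)"
        and T = "\<lambda>y. gen_image x \<and>\<^sub>e ext_map X T y"])
    show "y \<in> free_space (Pow X)" using y by (simp add: ext_space_def)
  qed (use X that in \<open>auto simp: linear_on_def E wedge_bilinear ext_map_gen_wedge_bvec\<close>)
  show ?thesis
  proof (rule linear_on_eqI[where S = "\<lambda>v. ext_map X T (ext_incl X v \<and>\<^sub>e y)"
        and T = "\<lambda>v. ext_incl X (T v) \<and>\<^sub>e ext_map X T y", OF X _ _ _ v])
    show "linear_on (free_space X) (\<lambda>v. ext_map X T (ext_incl X v \<and>\<^sub>e y))"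
      by (simp add: linear_on_def ext_incl_def linear_lin_ext E wedge_bilinear)
    show "linear_on (free_space X) (\<lambda>v. ext_incl X (T v) \<and>\<^sub>e ext_map X T y)"
      using T by (simp add: linear_on_def ext_incl_def linear_lin_ext wedge_bilinear)
  qed (simp add: gen ext_incl_bvec X)
qed

lemma ext_map_wedge_list:
  assumes "linear_on (free_space X) T" "\<And>i. i \<in> set is \<Longrightarrow> v i \<in> free_space X"
  shows "ext_map X T (wedge_list (map (\<lambda>i. ext_incl X (v i)) is)) =
    wedge_list (map (\<lambda>i. ext_incl X (T (v i))) is)"
  using assms(2)
proof (induction "is")
  case Nil
  show ?case using ext_map_bvec[of "{}"] by (simp add: wedge_list_Nil)
next
  case (Cons i "is")
  then show ?case
    by (simp add: wedge_list_Cons ext_map_wedge[OF assms(1)] wedge_list_in_ext_space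
        ext_incl_in_ext_space image_subset_iff)
qed

end

text \<open>
  The operators occurring in \<open>\<Psi>\<^sub>n\<close> are not restricted to the underlying space, whereas those of
  the general linear group are; this makes the difference immaterial.
\<close>

lemma ext_map_cong:
  assumes "finite X" "\<And>x. x \<in> X \<Longrightarrow> S (bvec x) = T (bvec x)"
  shows "ext_map X S = ext_map X T"
proof -
  have "map (\<lambda>x. ext_incl X (S (bvec x))) (sorted_list_of_set A) =
      map (\<lambda>x. ext_incl X (T (bvec x))) (sorted_list_of_set A)" if "A \<in> Pow X" for A
    using that assms finite_subset[OF _ assms(1)] by auto
  then show ?thesis
    unfolding ext_map_def by (intro ext lin_ext_cong arg_cong[where f = wedge_list])
qed

text \<open>The exterior algebra is a functor: \<open>T \<mapsto> \<And>T\<close> preserves identities and composition.\<close>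

lemma ext_map_hom:
  fixes X :: "'x::linorder set"
  assumes X: "finite X"
  shows "(\<lambda>T. restrict (ext_map X T) (ext_space X)) \<in>
    hom (GL (free_space X)) (GL (ext_space X :: ('x set \<Rightarrow> 'k::field) set))"
  unfolding ext_space_def
proof (rule hom_GL_I[OF group_GL])
  fix T :: "('x \<Rightarrow> 'k) \<Rightarrow> 'x \<Rightarrow> 'k" and v :: "'x set \<Rightarrow> 'k"
  show "linear_on (free_space (Pow X)) (ext_map X T)"
    by (rule linear_on_ext_map[OF X])
  show "ext_map X T v \<in> free_space (Pow X)"
    using ext_map_closed[OF X] by (simp add: ext_space_def)
next
  fix v :: "'x set \<Rightarrow> 'k"
  assume v: "v \<in> free_space (Pow X)"
  show "ext_map X \<one>\<^bsub>GL (free_space X)\<^esub> v = v"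
  proof (rule linear_on_eqI[where T = "\<lambda>v. v", OF _ linear_on_ext_map[OF X] _ _ v])
    fix S assume "S \<in> Pow X"
    then have "S \<subseteq> X" by simp
    then have "map (\<lambda>x. ext_incl X (\<one>\<^bsub>GL (free_space X)\<^esub> (bvec x) :: 'x \<Rightarrow> 'k)) (sorted_list_of_set S) =
        map (\<lambda>x. ext_incl X (bvec x)) (sorted_list_of_set S)"
      using finite_subset[OF _ X] by (auto simp: GL_one bvec_in_free_space)
    then show "ext_map X \<one>\<^bsub>GL (free_space X)\<^esub> (bvec S :: 'x set \<Rightarrow> 'k) = bvec S"
      by (simp only: ext_map_bvec[OF X \<open>S \<subseteq> X\<close>] flip: bvec_eq_wedge_list[OF X \<open>S \<subseteq> X\<close>])
  qed (use X in \<open>auto simp: linear_on_def\<close>)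
next
  fix S T :: "('x \<Rightarrow> 'k) \<Rightarrow> 'x \<Rightarrow> 'k" and v :: "'x set \<Rightarrow> 'k"
  assume S: "S \<in> carrier (GL (free_space X))" and T: "T \<in> carrier (GL (free_space X))"
    and v: "v \<in> free_space (Pow X)"
  show "ext_map X (S \<otimes>\<^bsub>GL (free_space X)\<^esub> T) v = ext_map X S (ext_map X T v)"
    unfolding GL_mult[OF S T]
  proof (rule linear_on_eqI[OF _ linear_on_ext_map[OF X] _ _ v])
    show "linear_on (free_space (Pow X)) (\<lambda>v. ext_map X S (ext_map X T v))"
      using linear_on_comp[OF linear_on_ext_map[OF X, of UNIV T] _ linear_on_ext_map[OF X, of UNIV S]]
      by (auto intro: linear_on_subset)
    fix A assume "A \<in> Pow X"
    then have A: "A \<subseteq> X" "finite A" using finite_subset[OF _ X] by auto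
    then have x: "bvec x \<in> free_space X" if "x \<in> A" for x
      using that by (auto intro: bvec_in_free_space)
    have "ext_map X S (ext_map X T (bvec A)) =
        wedge_list (map (\<lambda>x. ext_incl X (S (T (bvec x)))) (sorted_list_of_set A))"
      unfolding ext_map_bvec[OF X A(1)] using S A
      by (intro ext_map_wedge_list[OF X]) (auto simp: GL_carrier GL_closed[OF T] x)
    also have "\<dots> = ext_map X (compose (free_space X) S T) (bvec A)"
      unfolding ext_map_bvec[OF X A(1)] using A
      by (intro arg_cong[where f = wedge_list] map_cong) (auto simp: compose_eq x)
    finally show "ext_map X (compose (free_space X) S T) (bvec A) =
        ext_map X S (ext_map X T (bvec A))" ..
  qed (use X in auto)
qed

section \<open>The exterior representation\<close>

text \<open>The operator whose matrix is \<open>(a b; c d)\<close> on the coordinates \<open>i, i + 1\<close>.\<close>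

definition block_op :: "nat \<Rightarrow> 'k \<Rightarrow> 'k \<Rightarrow> 'k \<Rightarrow> 'k \<Rightarrow> (nat \<Rightarrow> 'k::field) \<Rightarrow> nat \<Rightarrow> 'k"
  where "block_op i a b c d v =
    (\<lambda>j. if j = i then a * v i + b * v (i + 1) else if j = i + 1 then c * v i + d * v (i + 1) else v j)"

lemma linear_on_block_op: "linear_on V (block_op i a b c d)"
  by (auto simp: linear_on_def block_op_def smul_def fun_eq_iff algebra_simps)

lemma block_op_closed:
  "i \<in> {1..<n} \<Longrightarrow> v \<in> free_space {1..n} \<Longrightarrow> block_op i a b c d v \<in> free_space {1..n}"
  by (auto simp: free_space_def block_op_def)

lemma block_op_bvec:
  "block_op i a b c d (bvec j) =
    (if j = i then a \<cdot>\<^sub>v bvec i + c \<cdot>\<^sub>v bvec (i + 1)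
     else if j = i + 1 then b \<cdot>\<^sub>v bvec i + d \<cdot>\<^sub>v bvec (i + 1) else bvec j)"
  by (auto simp: block_op_def bvec_def smul_def fun_eq_iff)

text \<open>
  The last three hypotheses are exactly what the entries of the braid relation, written out
  on the coordinates \<open>i, i + 1, i + 2\<close>, ask for.  Given \<open>a d = 0\<close> the determinant is \<open>- b c\<close>,
  which explains the form of the inverse.
\<close>

lemma braid_images_block_op:
  fixes a b c d :: "'k::field"
  assumes det: "b * c \<noteq> 0" and ad: "a * d = 0"
    and a: "a * (a + b * c - 1) = 0" and d: "d * (d + b * c - 1) = 0"
  shows "braid_images n (GL (free_space {1..n})) (\<lambda>i. restrict (block_op i a b c d) (free_space {1..n}))"
proof -
  let ?V = "free_space {1..n} :: (nat \<Rightarrow> 'k) set"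
  let ?T = "\<lambda>i. block_op i a b c d"
  let ?S = "\<lambda>i. block_op i (- d / (b * c)) (b / (b * c)) (c / (b * c)) (- a / (b * c))"
  have inv: "?S i (?T i v) = v" "?T i (?S i v) = v" for i v
    using det ad by (auto simp: block_op_def fun_eq_iff field_simps)
  have carrier: "restrict (?T i) ?V \<in> carrier (GL ?V)" if i: "i \<in> {1..<n}" for i
  proof (rule GL_I[where S = "?S i"])
    show "linear_on ?V (restrict (?T i) ?V)"
      by (simp only: linear_on_restrict linear_on_block_op)
  qed (use i in \<open>simp_all only: restrict_extensional restrict_apply' inv block_op_closed\<close>)
  have comm: "?T i (?T j v) = ?T j (?T i v)" if "i + 1 < j" for i j v
    using that by (auto simp: block_op_def fun_eq_iff)
  have braid: "?T i (?T (i + 1) (?T i v)) = ?T (i + 1) (?T i (?T (i + 1) v))" for i v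
  proof
    fix j
    let ?L = "?T i (?T (i + 1) (?T i v))" and ?R = "?T (i + 1) (?T i (?T (i + 1) v))"
    define x y z where "x = v i" and "y = v (i + 1)" and "z = v (i + 2)"
    have "a * (a * x + b * y) + b * (a * (c * x + d * y) + b * z) = a * x + b * (a * y + b * z)"
      using a ad by algebra
    then have 0: "?L i = ?R i"
      by (simp add: block_op_def x_def y_def z_def)
    have "c * (a * x + b * y) + d * (a * (c * x + d * y) + b * z) =
        a * (c * x + d * (a * y + b * z)) + b * (c * y + d * z)"
      using a d ad by algebra
    then have 1: "?L (i + 1) = ?R (i + 1)"
      by (simp add: block_op_def x_def y_def z_def)
    have "c * (c * x + d * y) + d * z = c * (c * x + d * (a * y + b * z)) + d * (c * y + d * z)"
      using d ad by algebra
    then have 2: "?L (i + 2) = ?R (i + 2)"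
      by (simp add: block_op_def x_def y_def z_def)
    have "?L j = ?R j" if "j \<notin> {i, i + 1, i + 2}"
      using that by (simp add: block_op_def)
    then show "?L j = ?R j"
      using 0 1 2 by blast
  qed
  have mult2: "restrict (?T i) ?V \<otimes>\<^bsub>GL ?V\<^esub> restrict (?T j) ?V = (\<lambda>v\<in>?V. ?T i (?T j v))"
    if "i \<in> {1..<n}" "j \<in> {1..<n}" for i j
    using that by (intro GL_mult_restrict carrier)
  have mult3: "restrict (?T i) ?V \<otimes>\<^bsub>GL ?V\<^esub> (restrict (?T j) ?V \<otimes>\<^bsub>GL ?V\<^esub> restrict (?T i) ?V) =
      (\<lambda>v\<in>?V. ?T i (?T j (?T i v)))" if "i \<in> {1..<n}" "j \<in> {1..<n}" for i j
  proof -
    have "restrict (?T j) ?V \<otimes>\<^bsub>GL ?V\<^esub> restrict (?T i) ?V \<in> carrier (GL ?V)"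
      using that by (intro monoid.m_closed group.is_monoid group_GL carrier)
    then show ?thesis
      unfolding mult2[OF that(2,1)] using that by (intro GL_mult_restrict carrier)
  qed
  show ?thesis
    unfolding braid_images_def
  proof (intro conjI ballI allI impI)
    show "restrict (?T i) ?V \<in> carrier (GL ?V)" if "i \<in> {1..<n}" for i
      using that by (rule carrier)
    show "restrict (?T i) ?V \<otimes>\<^bsub>GL ?V\<^esub> restrict (?T j) ?V = restrict (?T j) ?V \<otimes>\<^bsub>GL ?V\<^esub> restrict (?T i) ?V"
      if "i \<in> {1..<n}" "j \<in> {1..<n}" "i + 1 < j" for i j
      by (simp only: mult2 that comm[OF that(3)])
    show "restrict (?T i) ?V \<otimes>\<^bsub>GL ?V\<^esub> (restrict (?T (i + 1)) ?V \<otimes>\<^bsub>GL ?V\<^esub> restrict (?T i) ?V) =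
        restrict (?T (i + 1)) ?V \<otimes>\<^bsub>GL ?V\<^esub> (restrict (?T i) ?V \<otimes>\<^bsub>GL ?V\<^esub> restrict (?T (i + 1)) ?V)"
      if "1 \<le> i \<and> i + 1 < n" for i
    proof -
      have "i \<in> {1..<n}" "i + 1 \<in> {1..<n}" using that by auto
      then show ?thesis by (simp only: mult3 braid)
    qed
  qed
qed

lemma t0_half_nonzero: "t0_half \<noteq> 0"
  by (simp add: t0_half_def Zero_fract_def eq_fract)

lemma F_gen_eq:
  "i \<in> {1..<n} \<Longrightarrow> F_gen n i =
    restrict (block_op i (1 - inverse t0) (inverse t0_half) (inverse t0_half) 0) (W_space n)"
  unfolding F_gen_def W_space_def
  by (intro restrict_ext, rule linear_on_eqI[OF _ linear_on_lin_ext linear_on_block_op])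
    (auto simp: lin_ext_bvec block_op_bvec, auto simp: smul_def fun_eq_iff)

lemma G_gen_eq:
  "i \<in> {1..<n} \<Longrightarrow> G_gen n i =
    restrict (block_op i 0 (- t0_half) (- t0_half) (1 - t0)) (W_space n)"
  unfolding G_gen_def W_space_def
  by (intro restrict_ext, rule linear_on_eqI[OF _ linear_on_lin_ext linear_on_block_op])
    (auto simp: lin_ext_bvec block_op_bvec, auto simp: smul_def fun_eq_iff)

lemma braid_images_F_gen: "braid_images n (GL (W_space n)) (F_gen n)"
proof -
  have "braid_images n (GL (W_space n)) (\<lambda>i. restrict (block_op i (1 - inverse t0) (inverse t0_half) (inverse t0_half) 0) (W_space n))"
    unfolding W_space_def
    by (rule braid_images_block_op) (simp_all add: t0_half_nonzero t0_def power2_eq_square)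
  then show ?thesis
    by (subst braid_images_cong[OF F_gen_eq])
qed

lemma braid_images_G_gen: "braid_images n (GL (W_space n)) (G_gen n)"
proof -
  have "braid_images n (GL (W_space n)) (\<lambda>i. restrict (block_op i 0 (- t0_half) (- t0_half) (1 - t0)) (W_space n))"
    unfolding W_space_def
    by (rule braid_images_block_op) (simp_all add: t0_half_nonzero t0_def power2_eq_square)
  then show ?thesis
    by (subst braid_images_cong[OF G_gen_eq])
qed

lemma group_GL_W_space: "group (GL (W_space n))"
  unfolding W_space_def by (rule group_GL)

lemma F_rep_hom: "F_rep n \<in> hom (braid_group n) (GL (W_space n))"
  unfolding F_rep_def by (rule braid_lift_hom[OF group_GL_W_space braid_images_F_gen])

lemma G_rep_hom: "G_rep n \<in> hom (braid_group n) (GL (W_space n))"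
  unfolding G_rep_def by (rule braid_lift_hom[OF group_GL_W_space braid_images_G_gen])

lemma comp_linear:
  "(u + v) \<circ> h = (u \<circ> h) + (v \<circ> h)" "(c \<cdot>\<^sub>v v) \<circ> h = c \<cdot>\<^sub>v (v \<circ> h)"
  by (simp_all add: fun_eq_iff smul_apply)

lemma free_space_sum_components:
  assumes "v \<in> free_space (X <+> Z)"
  shows "v \<circ> Inl \<in> free_space X" "v \<circ> Inr \<in> free_space Z"
  using assms by (auto simp: free_space_def)

lemma linear_on_direct_sum_map:
  assumes "linear_on (free_space X) S" "linear_on (free_space Z) T"
  shows "linear_on (free_space (X <+> Z)) (direct_sum_map S T)"
  using assms
  by (simp add: free_space_sum_components[of _ X Z] linear_on_def direct_sum_map_def comp_linear fun_eq_iff smul_apply split: sum.split)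

lemma direct_sum_hom_GL:
  fixes \<rho> :: "'g \<Rightarrow> ('x \<Rightarrow> 'k::field) \<Rightarrow> 'x \<Rightarrow> 'k" and \<tau> :: "'g \<Rightarrow> ('y \<Rightarrow> 'k) \<Rightarrow> 'y \<Rightarrow> 'k"
  assumes B: "group B"
    and \<rho>: "\<rho> \<in> hom B (GL (free_space X))" and \<tau>: "\<tau> \<in> hom B (GL (free_space Z))"
  shows "(\<lambda>b. restrict (direct_sum_map (\<rho> b) (\<tau> b)) (free_space (X <+> Z))) \<in>
    hom B (GL (free_space (X <+> Z)))"
proof (rule hom_GL_I[OF B])
  have carrier: "\<rho> b \<in> carrier (GL (free_space X))" "\<tau> b \<in> carrier (GL (free_space Z))"
    if "b \<in> carrier B" for b
    using hom_in_carrier[OF \<rho> that] hom_in_carrier[OF \<tau> that] .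
  have pieces: "direct_sum_map S T v \<circ> Inl = S (v \<circ> Inl)" "direct_sum_map S T v \<circ> Inr = T (v \<circ> Inr)"
    for S :: "('x \<Rightarrow> 'k) \<Rightarrow> 'x \<Rightarrow> 'k" and T :: "('y \<Rightarrow> 'k) \<Rightarrow> 'y \<Rightarrow> 'k" and v
    by (simp_all add: direct_sum_map_def fun_eq_iff)
  fix b assume b: "b \<in> carrier B"
  have lin: "linear_on (free_space X) (\<rho> b)" "linear_on (free_space Z) (\<tau> b)"
    using carrier[OF b] by (simp_all add: GL_carrier)
  show "linear_on (free_space (X <+> Z)) (direct_sum_map (\<rho> b) (\<tau> b))"
    using lin by (rule linear_on_direct_sum_map)
  show "direct_sum_map (\<rho> b) (\<tau> b) v \<in> free_space (X <+> Z)"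
    if v: "v \<in> free_space (X <+> Z)" for v
    using GL_closed[OF carrier(1)[OF b] free_space_sum_components(1)[OF v]] GL_closed[OF carrier(2)[OF b] free_space_sum_components(2)[OF v]]
    by (auto simp: direct_sum_map_def free_space_def split: sum.split)
  show "direct_sum_map (\<rho> (a \<otimes>\<^bsub>B\<^esub> b)) (\<tau> (a \<otimes>\<^bsub>B\<^esub> b)) v =
      direct_sum_map (\<rho> a) (\<tau> a) (direct_sum_map (\<rho> b) (\<tau> b) v)"
    if a: "a \<in> carrier B" and v: "v \<in> free_space (X <+> Z)" for a v
  proof -
    have "\<rho> (a \<otimes>\<^bsub>B\<^esub> b) = compose (free_space X) (\<rho> a) (\<rho> b)"
      "\<tau> (a \<otimes>\<^bsub>B\<^esub> b) = compose (free_space Z) (\<tau> a) (\<tau> b)"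
      using hom_mult[OF \<rho> a b] hom_mult[OF \<tau> a b] a b by (simp_all add: GL_mult carrier)
    then show ?thesis
      using free_space_sum_components[OF v] unfolding direct_sum_map_def[of "\<rho> (a \<otimes>\<^bsub>B\<^esub> b)"] direct_sum_map_def[of "\<rho> a"]
      by (simp add: pieces compose_eq)
  qed
next
  fix v :: "'x + 'y \<Rightarrow> 'k" assume v: "v \<in> free_space (X <+> Z)"
  have "\<rho> \<one>\<^bsub>B\<^esub> = (\<lambda>w\<in>free_space X. w)" "\<tau> \<one>\<^bsub>B\<^esub> = (\<lambda>w\<in>free_space Z. w)"
    using hom_one[OF \<rho> B group_GL] hom_one[OF \<tau> B group_GL] by (simp_all add: GL_one)
  then show "direct_sum_map (\<rho> \<one>\<^bsub>B\<^esub>) (\<tau> \<one>\<^bsub>B\<^esub>) v = v"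
    using free_space_sum_components[OF v] by (simp add: direct_sum_map_def fun_eq_iff split: sum.split)
qed

lemma finite_FG_basis: "finite (FG_basis n)"
  by (simp add: FG_basis_def)

lemma Psi_hom: "Psi n \<in> hom (braid_group n) (GL (FG_ext n))"
proof -
  let ?D = "\<lambda>b. restrict (direct_sum_map (F_rep n b) (G_rep n b)) (free_space (FG_basis n))"
  have "?D \<in> hom (braid_group n) (GL (free_space (FG_basis n)))"
    unfolding FG_basis_def
    by (rule direct_sum_hom_GL[OF group_braid_group F_rep_hom[unfolded W_space_def]
          G_rep_hom[unfolded W_space_def]])
  then have "(\<lambda>T. restrict (ext_map (FG_basis n) T) (FG_ext n)) \<circ> ?D \<in> hom (braid_group n) (GL (FG_ext n))"
    unfolding FG_ext_def by (rule hom_compose[OF _ ext_map_hom[OF finite_FG_basis]])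
  moreover have "ext_map (FG_basis n) (?D b) =
      ext_map (FG_basis n) (direct_sum_map (F_rep n b) (G_rep n b))" for b
    by (rule ext_map_cong[OF finite_FG_basis]) (simp add: bvec_in_free_space)
  ultimately show ?thesis
    by (auto simp: hom_def Psi_def group.is_monoid[OF group_braid_group, THEN monoid.m_closed])
qed

section \<open>The comparison map on basis words\<close>

text \<open>
  The factors of the image of a word in the order of the comparison map.  Since every \<open>f\<close>
  precedes every \<open>g\<close> in the order on the disjoint sum, this list is increasing.
\<close>

definition word_gens :: "nat \<Rightarrow> nat list \<Rightarrow> (nat + nat) list"
  where "word_gens n w =
    map Inl (filter (\<lambda>k. w ! (k - 1) \<in> {3, 4}) [1..<n + 1]) @
    map Inr (filter (\<lambda>k. w ! (k - 1) \<in> {1, 3}) [1..<n + 1])"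

lemma finite_tensor_basis: "finite (tensor_basis n)"
  using finite_lists_length_eq[of "{1..4 :: nat}" n] by (simp add: tensor_basis_def conj_commute)

lemma set_word_gens_subset: "set (word_gens n w) \<subseteq> FG_basis n"
  by (auto simp: word_gens_def FG_basis_def)

lemma sorted_map_Inl_Inr:
  fixes xs :: "'a::linorder list" and ys :: "'b::linorder list"
  assumes "sorted xs" "sorted ys"
  shows "sorted (map Inl xs @ map Inr ys)"
  using assms by (auto simp: sorted_append sorted_map less_eq_sum_def)

lemma wedge_list_word_gens:
  "wedge_list (map (\<lambda>x. ext_incl (FG_basis n) (bvec x)) (word_gens n w)) = bvec (set (word_gens n w))"
proof -
  have "sorted (word_gens n w)"
    unfolding word_gens_def by (intro sorted_map_Inl_Inr sorted_wrt_filter) (simp_all del: upt_Suc)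
  moreover have "distinct (word_gens n w)"
    by (auto simp: word_gens_def distinct_map simp del: upt_Suc)
  ultimately have "sorted_list_of_set (set (word_gens n w)) = word_gens n w"
    by (simp add: sorted_list_of_set.idem_if_sorted_distinct)
  then show ?thesis
    by (simp add: bvec_eq_wedge_list[OF finite_FG_basis set_word_gens_subset])
qed

lemma I_map_eq_wedge_list:
  "I_map n = lin_ext (tensor_basis n)
    (\<lambda>w. wedge_list (map (\<lambda>x. ext_incl (FG_basis n) (bvec x)) (word_gens n w)))"
proof -
  let ?f = "\<lambda>w :: nat list. map (f_ext n) (filter (\<lambda>k. w ! (k - 1) \<in> {3, 4}) [1..<n + 1])"
  let ?g = "\<lambda>w :: nat list. map (g_ext n) (filter (\<lambda>k. w ! (k - 1) \<in> {1, 3}) [1..<n + 1])"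
  have "wedge_list (?f w) \<and>\<^sub>e wedge_list (?g w) = wedge_list (?f w @ ?g w)" for w
    by (rule wedge_list_append[OF finite_FG_basis[of n], symmetric])
      (auto simp: g_ext_def ext_incl_in_ext_space)
  moreover have "?f w @ ?g w = map (\<lambda>x. ext_incl (FG_basis n) (bvec x)) (word_gens n w)" for w
    by (simp add: word_gens_def f_ext_def g_ext_def del: upt_Suc)
  ultimately show ?thesis
    unfolding I_map_def by simp
qed

lemma bij_betw_set_word_gens:
  "bij_betw (\<lambda>w. set (word_gens n w)) (tensor_basis n) (Pow (FG_basis n))"
proof -
  \<comment> \<open>The inverse: read off each letter from the presence of \<open>f\<^sub>k\<close> and \<open>g\<^sub>k\<close>.\<close>
  define letter :: "bool \<Rightarrow> bool \<Rightarrow> nat"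
    where "letter f g = (if f then if g then 3 else 4 else if g then 1 else 2)" for f g
  define word where "word S = map (\<lambda>k. letter (Inl k \<in> S) (Inr k \<in> S)) [1..<n + 1]"
    for S :: "(nat + nat) set"
  have mem: "Inl k \<in> set (word_gens n w) \<longleftrightarrow> k \<in> {1..n} \<and> w ! (k - 1) \<in> {3, 4}"
    "Inr k \<in> set (word_gens n w) \<longleftrightarrow> k \<in> {1..n} \<and> w ! (k - 1) \<in> {1, 3}" for k w
    by (auto simp: word_gens_def simp del: upt_Suc)
  have "word (set (word_gens n w)) = w" if w: "w \<in> tensor_basis n" for w
  proof (rule nth_equalityI)
    show "length (word (set (word_gens n w))) = length w"
      using w by (simp add: word_def tensor_basis_def)
    fix j assume "j < length (word (set (word_gens n w)))"
    then have j: "j < n" by (simp add: word_def del: upt_Suc)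
    then have "w ! j \<in> {1..4}"
      using w by (metis (mono_tags, lifting) mem_Collect_eq nth_mem subsetD tensor_basis_def)
    then have "w ! j = 1 \<or> w ! j = 2 \<or> w ! j = 3 \<or> w ! j = 4" by auto
    then show "word (set (word_gens n w)) ! j = w ! j"
      using j by (auto simp: word_def mem letter_def simp del: upt_Suc)
  qed
  moreover have "set (word_gens n (word S)) = S" if S: "S \<subseteq> FG_basis n" for S
  proof (rule Set.set_eqI)
    fix x
    have "word S ! (k - 1) = letter (Inl k \<in> S) (Inr k \<in> S)" if "k \<in> {1..n}" for k
      using that by (cases k) (auto simp: word_def simp del: upt_Suc)
    moreover have "letter f g \<in> {3, 4} \<longleftrightarrow> f" "letter f g \<in> {1, 3} \<longleftrightarrow> g" for f g
      by (simp_all add: letter_def)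
    moreover have "Inl k \<in> S \<Longrightarrow> k \<in> {1..n}" "Inr k \<in> S \<Longrightarrow> k \<in> {1..n}" for k
      using S by (auto simp: FG_basis_def)
    ultimately show "x \<in> set (word_gens n (word S)) \<longleftrightarrow> x \<in> S"
      by (cases x) (simp_all only: mem, metis+)
  qed
  moreover have "word S \<in> tensor_basis n" for S
    by (auto simp: word_def tensor_basis_def letter_def)
  ultimately show ?thesis
    by (intro bij_betw_byWitness[where f' = word])
      (auto simp only: Pow_iff image_subset_iff set_word_gens_subset)
qed

lemma linear_on_I_map: "linear_on V (I_map n)"
  unfolding I_map_def by (rule linear_on_lin_ext)

lemma bij_betw_I_map: "bij_betw (I_map n) (tensor_power n) (FG_ext n)"
  unfolding I_map_eq_wedge_list wedge_list_word_gens tensor_power_def FG_ext_def ext_space_def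
  by (rule bij_betw_lin_ext_bvec[OF finite_tensor_basis bij_betw_set_word_gens])

section \<open>The R-matrix generators on basis words\<close>

lemma linear_tensor_vec_left:
  "linear_on V (\<lambda>x. tensor_vec p x y)" 
  by (auto simp: linear_on_def tensor_vec_def fun_eq_iff smul_apply algebra_simps)

lemma linear_tensor_vec_right:
  "linear_on V (\<lambda>y. tensor_vec p x y)"
  by (auto simp: linear_on_def tensor_vec_def fun_eq_iff smul_apply algebra_simps)

text \<open>The tensor \<open>u \<otimes> r \<otimes> v\<close> for words \<open>u, v\<close> and a vector \<open>r\<close> of \<open>W \<otimes> W\<close>.\<close>

definition insert_pair :: "nat list \<Rightarrow> (nat list \<Rightarrow> ratfun) \<Rightarrow> nat list \<Rightarrow> nat list \<Rightarrow> ratfun"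
  where "insert_pair u r v = tensor_vec (length u + 2) (tensor_vec (length u) (bvec u) r) (bvec v)"

lemma linear_on_insert_pair: "linear_on V (\<lambda>r. insert_pair u r v)"
proof -
  have "linear_on UNIV (\<lambda>r. insert_pair u r v)"
    unfolding insert_pair_def
    by (rule linear_on_comp[OF linear_tensor_vec_right subset_UNIV linear_tensor_vec_left])
  then show ?thesis by (rule linear_on_subset) simp
qed

lemma insert_pair_bvec: "insert_pair u (bvec [a, b]) v = bvec (u @ [a, b] @ v)"
  by (simp add: insert_pair_def tensor_vec_bvec)

lemma R_gen_bvec:
  assumes i: "i \<in> {1..<n}" and uv: "length u = i - 1" "length v = n - i - 1"
    and w: "set u \<subseteq> {1..4}" "set v \<subseteq> {1..4}" "a \<in> {1..4}" "b \<in> {1..4}"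
  shows "R_gen n i (bvec (u @ [a, b] @ v)) = insert_pair u (R_basis (a, b)) v"
proof -
  let ?w = "u @ [a, b] @ v"
  have len: "length u + 2 = i + 1" and ni: "i + 1 + (n - i - 1) = n" "i - 1 + 2 = i + 1" using i uv by auto
  have mem: "?w \<in> tensor_basis n" "u @ [a, b] \<in> tensor_basis (i + 1)" "[a, b] \<in> tensor_basis 2"
    using i uv w by (auto simp: tensor_basis_def)
  have split: "take (i + 1) ?w = u @ [a, b]" "drop (i + 1) ?w = v"
    "take (i - 1) (u @ [a, b]) = u" "drop (i - 1) (u @ [a, b]) = [a, b]"
    using i uv by auto
  have "R_map (bvec [a, b]) = R_basis (a, b)"
    unfolding R_map_def by (subst lin_ext_bvec[OF finite_tensor_basis mem(3)]) simp
  then have "tensor_map (i - 1) 2 id R_map (bvec (u @ [a, b])) = tensor_vec (length u) (bvec u) (R_basis (a, b))"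
    unfolding tensor_map_def ni
    by (subst lin_ext_bvec[OF finite_tensor_basis mem(2)]) (simp only: split id_apply uv)
  then have "tensor_map (i + 1) (n - i - 1) (tensor_map (i - 1) 2 id R_map) id (bvec ?w) =
      insert_pair u (R_basis (a, b)) v"
    unfolding tensor_map_def[of "i + 1"] ni(1) insert_pair_def
    by (subst lin_ext_bvec[OF finite_tensor_basis mem(1)]) (simp only: split id_apply len)
  then show ?thesis
    using mem(1) by (simp add: R_gen_def tensor_power_def bvec_in_free_space)
qed

lemma R_basis_in_free_space: "R_basis (a, b) \<in> free_space (tensor_basis 2)"
  by (auto simp: R_basis_def free_space_def tensor_basis_def bvec_def smul_def)

lemma tensor_basis_2E:
  assumes "w \<in> tensor_basis 2"
  obtains a b where "w = [a, b]" "a \<in> {1..4}" "b \<in> {1..4}"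
  using assms by (auto simp: tensor_basis_def numeral_2_eq_2 length_Suc_conv)

lemma insert_pair_closed:
  assumes r: "r \<in> free_space (tensor_basis 2)"
    and uv: "length u + length v + 2 = n" "set u \<subseteq> {1..4}" "set v \<subseteq> {1..4}"
  shows "insert_pair u r v \<in> tensor_power n"
proof -
  have "insert_pair u r v = lin_ext (tensor_basis 2) (\<lambda>w. insert_pair u (bvec w) v) r"
    by (rule linear_on_eq_lin_ext[OF finite_tensor_basis linear_on_insert_pair r])
  also have "\<dots> \<in> tensor_power n"
    unfolding tensor_power_def
  proof (rule lin_ext_in_free_space)
    fix w assume "w \<in> tensor_basis 2"
    then show "insert_pair u (bvec w) v \<in> free_space (tensor_basis n)"
      using uv by (elim tensor_basis_2E)
        (simp add: insert_pair_bvec bvec_in_free_space tensor_basis_def[of n])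
  qed
  finally show ?thesis .
qed

lemma tensor_basis_split:
  assumes i: "i \<in> {1..<n}" and w: "w \<in> tensor_basis n"
  obtains u a b v where "w = u @ [a, b] @ v" "length u = i - 1" "length v = n - i - 1"
    "set u \<subseteq> {1..4}" "set v \<subseteq> {1..4}" "a \<in> {1..4}" "b \<in> {1..4}"
proof -
  have len: "length w = n" and set: "set w \<subseteq> {1..4}" using w by (auto simp: tensor_basis_def)
  have "drop (i - 1) w = w ! (i - 1) # drop i w"
    using i len Cons_nth_drop_Suc[of "i - 1" w] by auto
  moreover have "drop i w = w ! i # drop (i + 1) w"
    using i len Cons_nth_drop_Suc[of i w] by simp
  ultimately have "w = take (i - 1) w @ [w ! (i - 1), w ! i] @ drop (i + 1) w"
    using append_take_drop_id[of "i - 1" w] by simp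
  moreover have "w ! (i - 1) \<in> {1..4}" "w ! i \<in> {1..4}"
    using i len set by (auto simp: subset_iff simp del: atLeastAtMost_iff)
  ultimately show thesis
    using i len set set_take_subset[of "i - 1" w] set_drop_subset[of "i + 1" w]
    by (intro that[of "take (i - 1) w" "w ! (i - 1)" "w ! i" "drop (i + 1) w"]) auto
qed

text \<open>
  For \<open>A = {3, 4}\<close> (\<open>A = {1, 3}\<close>) these are the indices of the factors \<open>f\<close> (\<open>g\<close>) contributed by the
  letters \<open>a, b\<close> at positions \<open>i, i + 1\<close>.
\<close>

definition pair_positions :: "nat \<Rightarrow> nat set \<Rightarrow> nat \<Rightarrow> nat \<Rightarrow> nat list"
  where "pair_positions i A a b = (if a \<in> A then [i] else []) @ (if b \<in> A then [i + 1] else [])"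

lemma filter_positions_split:
  assumes i: "i \<in> {1..<n}" and u: "length u = i - 1"
  shows "filter (\<lambda>k. (u @ [a, b] @ v) ! (k - 1) \<in> A) [1..<n + 1] =
    filter (\<lambda>k. u ! (k - 1) \<in> A) [1..<i] @ pair_positions i A a b @
    filter (\<lambda>k. v ! (k - i - 2) \<in> A) [i + 2..<n + 1]"
proof -
  let ?w = "u @ [a, b] @ v"
  have "[1..<n + 1] = [1..<i] @ [i..<i + 2] @ [i + 2..<n + 1]"
    using i upt_add_eq_append[of 1 i "n + 1 - i"] upt_add_eq_append[of i "i + 2" "n - 1 - i"] by simp
  also have "[i..<i + 2] = [i, i + 1]" by (simp add: upt_rec)
  finally have split: "[1..<n + 1] = [1..<i] @ [i, i + 1] @ [i + 2..<n + 1]" .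
  have 1: "filter (\<lambda>k. ?w ! (k - 1) \<in> A) [1..<i] = filter (\<lambda>k. u ! (k - 1) \<in> A) [1..<i]"
    by (rule filter_cong) (use u in \<open>auto simp: nth_append\<close>)
  have 2: "filter (\<lambda>k. ?w ! (k - 1) \<in> A) [i, i + 1] = pair_positions i A a b"
    using i u by (auto simp: pair_positions_def nth_append)
  have "?w ! (k - 1) = v ! (k - i - 2)" if "i + 2 \<le> k" for k
  proof -
    have "k - 1 = length (u @ [a, b]) + (k - i - 2)" using i u that by simp
    then show ?thesis by (metis append_assoc nth_append_length_plus)
  qed
  then have 3: "filter (\<lambda>k. ?w ! (k - 1) \<in> A) [i + 2..<n + 1] = filter (\<lambda>k. v ! (k - i - 2) \<in> A) [i + 2..<n + 1]"
    by (intro filter_cong) auto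
  show ?thesis
    unfolding split filter_append 1 2 3 ..
qed

section \<open>Intertwining\<close>

lemma wedge_list_sandwich:
  fixes h :: "'y \<Rightarrow> 'x::linorder \<Rightarrow> 'k::field"
  assumes X: "finite X"
  defines "W \<equiv> \<lambda>xs. wedge_list (map (\<lambda>x. ext_incl X (h x)) xs)"
  shows "W (a @ p @ b @ q @ c) = W a \<and>\<^sub>e W p \<and>\<^sub>e W b \<and>\<^sub>e W q \<and>\<^sub>e W c"
proof -
  have "W (xs @ ys) = W xs \<and>\<^sub>e W ys" for xs ys
    unfolding W_def map_append
    by (rule wedge_list_append[OF X]) (auto simp: ext_incl_in_ext_space)
  then show ?thesis by (simp add: wedge_assoc)
qed

lemma Psi_braid_gen:
  assumes i: "i \<in> {1..<n}"
  shows "Psi n (braid_gen n i) =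
    restrict (ext_map (FG_basis n) (direct_sum_map (F_gen n i) (G_gen n i))) (FG_ext n)"
  using braid_gen_carrier[OF i]
    braid_lift_gen[OF group_GL_W_space braid_images_F_gen i]
    braid_lift_gen[OF group_GL_W_space braid_images_G_gen i]
  by (simp add: Psi_def F_rep_def G_rep_def)

lemma linear_on_FG_gen:
  assumes i: "i \<in> {1..<n}"
  shows "linear_on (free_space (FG_basis n)) (direct_sum_map (F_gen n i) (G_gen n i))"
  unfolding FG_basis_def
  by (rule linear_on_direct_sum_map)
    (simp_all add: F_gen_eq[OF i] G_gen_eq[OF i] W_space_def linear_on_restrict linear_on_block_op)

lemma direct_sum_map_gen_bvec:
  assumes i: "i \<in> {1..<n}" and k: "k \<in> {1..n}"
  defines "T \<equiv> direct_sum_map (F_gen n i) (G_gen n i)"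
  shows "T (bvec (Inl k)) =
      (if k = i then (1 - inverse t0) \<cdot>\<^sub>v bvec (Inl i) + inverse t0_half \<cdot>\<^sub>v bvec (Inl (i + 1))
       else if k = i + 1 then inverse t0_half \<cdot>\<^sub>v bvec (Inl i) else bvec (Inl k))"
    and "T (bvec (Inr k)) =
      (if k = i then (- t0_half) \<cdot>\<^sub>v bvec (Inr (i + 1))
       else if k = i + 1 then (- t0_half) \<cdot>\<^sub>v bvec (Inr i) + (1 - t0) \<cdot>\<^sub>v bvec (Inr (i + 1))
       else bvec (Inr k))"
proof -
  have comp: "bvec (Inl k) \<circ> Inl = bvec k" "bvec (Inl k) \<circ> Inr = 0"
    "bvec (Inr k) \<circ> Inr = bvec k" "bvec (Inr k) \<circ> Inl = 0"
    by (auto simp: bvec_def fun_eq_iff)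
  have W: "bvec k \<in> W_space n" "0 \<in> W_space n"
    using k by (simp_all add: W_space_def bvec_in_free_space free_space_zero)
  have zero: "block_op i a b c d 0 = 0" for a b c d :: ratfun
    by (auto simp: block_op_def fun_eq_iff)
  show "T (bvec (Inl k)) =
      (if k = i then (1 - inverse t0) \<cdot>\<^sub>v bvec (Inl i) + inverse t0_half \<cdot>\<^sub>v bvec (Inl (i + 1))
       else if k = i + 1 then inverse t0_half \<cdot>\<^sub>v bvec (Inl i) else bvec (Inl k))"
    unfolding T_def direct_sum_map_def comp F_gen_eq[OF i] G_gen_eq[OF i] restrict_apply'[OF W(1)]
      restrict_apply'[OF W(2)] zero block_op_bvec
    by (auto simp: fun_eq_iff smul_apply bvec_def split: sum.split)
  show "T (bvec (Inr k)) =
      (if k = i then (- t0_half) \<cdot>\<^sub>v bvec (Inr (i + 1))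
       else if k = i + 1 then (- t0_half) \<cdot>\<^sub>v bvec (Inr i) + (1 - t0) \<cdot>\<^sub>v bvec (Inr (i + 1))
       else bvec (Inr k))"
    unfolding T_def direct_sum_map_def comp F_gen_eq[OF i] G_gen_eq[OF i] restrict_apply'[OF W(1)]
      restrict_apply'[OF W(2)] zero block_op_bvec
    by (auto simp: fun_eq_iff smul_apply bvec_def split: sum.split)
qed

text \<open>
  Both sides are linear combinations of the sixteen vectors \<open>P \<and> x \<and> Q \<and> y \<and> S\<close> with \<open>x\<close> a
  monomial in \<open>f\<^sub>i, f\<^sub>i\<^sub>+\<^sub>1\<close> and \<open>y\<close> one in \<open>g\<^sub>i, g\<^sub>i\<^sub>+\<^sub>1\<close>: on the left by applying \<open>\<sigma>\<^sub>i\<close> to \<open>x\<close> and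
  \<open>y\<close>, on the right through the entries of \<open>R\<close>.  The coefficients agree for each \<open>(a, b)\<close>.
\<close>

lemma I_map_R_gen_bvec:
  assumes i: "i \<in> {1..<n}" and uv: "length u = i - 1" "length v = n - i - 1"
    and w: "set u \<subseteq> {1..4}" "set v \<subseteq> {1..4}" "a \<in> {1..4}" "b \<in> {1..4}"
  shows "ext_map (FG_basis n) (direct_sum_map (F_gen n i) (G_gen n i)) (I_map n (bvec (u @ [a, b] @ v))) =
    I_map n (insert_pair u (R_basis (a, b)) v)"
proof -
  let ?X = "FG_basis n"
  define T where "T = direct_sum_map (F_gen n i) (G_gen n i)"
  \<comment> \<open>\<open>P, Q, S\<close> collect the factors away from \<open>i, i + 1\<close>; \<open>h\<close> will be \<open>bvec\<close> or its composite with \<open>T\<close>.\<close>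
  define pre where "pre A = filter (\<lambda>k. u ! (k - 1) \<in> A) [1..<i]" for A
  define post where "post A = filter (\<lambda>k. v ! (k - i - 2) \<in> A) [i + 2..<n + 1]" for A
  define P where "P h = wedge_list (map (\<lambda>x. ext_incl ?X (h x)) (map Inl (pre {3, 4})))"
    for h :: "nat + nat \<Rightarrow> nat + nat \<Rightarrow> ratfun"
  define Q where "Q h = wedge_list (map (\<lambda>x. ext_incl ?X (h x)) (map Inl (post {3, 4}) @ map Inr (pre {1, 3})))"
    for h :: "nat + nat \<Rightarrow> nat + nat \<Rightarrow> ratfun"
  define S where "S h = wedge_list (map (\<lambda>x. ext_incl ?X (h x)) (map Inr (post {1, 3})))"
    for h :: "nat + nat \<Rightarrow> nat + nat \<Rightarrow> ratfun"
  define f1 f2 g1 g2 :: "(nat + nat) set \<Rightarrow> ratfun" where "f1 = ext_incl ?X (bvec (Inl i))" and "f2 = ext_incl ?X (bvec (Inl (i + 1)))"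
    and "g1 = ext_incl ?X (bvec (Inr i))" and "g2 = ext_incl ?X (bvec (Inr (i + 1)))"
  let ?w = "\<lambda>c d. u @ [c, d] @ v"
  have w_mem: "?w c d \<in> tensor_basis n" if "c \<in> {1..4}" "d \<in> {1..4}" for c d
  proof -
    have "length (?w c d) = i - 1 + (2 + (n - i - 1))" using uv by simp
    also have "\<dots> = n" using i by (simp only: atLeastLessThan_iff) linarith
    finally show ?thesis using that w by (simp add: tensor_basis_def)
  qed
  have gens: "word_gens n (?w c d) = map Inl (pre {3, 4}) @ map Inl (pair_positions i {3, 4} c d) @
      (map Inl (post {3, 4}) @ map Inr (pre {1, 3})) @ map Inr (pair_positions i {1, 3} c d) @
      map Inr (post {1, 3})" for c d
    unfolding word_gens_def filter_positions_split[OF i uv(1)] pre_def post_def by simp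
  have I_w: "I_map n (bvec (?w c d)) = wedge_list (map (\<lambda>x. ext_incl ?X (bvec x)) (word_gens n (?w c d)))"
    if "c \<in> {1..4}" "d \<in> {1..4}" for c d
    unfolding I_map_eq_wedge_list by (rule lin_ext_bvec[OF finite_tensor_basis w_mem[OF that]])

  have fixed: "T (bvec (Inl k)) = bvec (Inl k)" "T (bvec (Inr k)) = bvec (Inr k)"
    if "k \<in> set (pre A) \<union> set (post A)" for k A
  proof -
    have "k \<in> {1..n}" "k \<noteq> i" "k \<noteq> i + 1"
      using that i by (auto simp: pre_def post_def)
    then show "T (bvec (Inl k)) = bvec (Inl k)" "T (bvec (Inr k)) = bvec (Inr k)"
      unfolding T_def by (simp_all only: direct_sum_map_gen_bvec[OF i] if_False)
  qed
  have map_fixed: "map (\<lambda>x. ext_incl ?X (T (bvec x))) xs = map (\<lambda>x. ext_incl ?X (bvec x)) xs"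
    if "\<And>x. x \<in> set xs \<Longrightarrow> T (bvec x) = bvec x" for xs
    by (simp add: that)
  have PQS: "P (\<lambda>x. T (bvec x)) = P bvec" "Q (\<lambda>x. T (bvec x)) = Q bvec" "S (\<lambda>x. T (bvec x)) = S bvec"
    unfolding P_def Q_def S_def
    by (rule arg_cong[where f = wedge_list], rule map_fixed, (use fixed in auto)[1])+

  define sandwich where "sandwich x y = P bvec \<and>\<^sub>e x \<and>\<^sub>e Q bvec \<and>\<^sub>e y \<and>\<^sub>e S bvec" for x y
  let ?f = "\<lambda>h c d. wedge_list (map (\<lambda>x. ext_incl ?X (h x)) (map Inl (pair_positions i {3, 4} c d)))"
  let ?g = "\<lambda>h c d. wedge_list (map (\<lambda>x. ext_incl ?X (h x)) (map Inr (pair_positions i {1, 3} c d)))"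
  have R: "I_map n (bvec (?w c d)) = sandwich (?f bvec c d) (?g bvec c d)"
    if "c \<in> {1..4}" "d \<in> {1..4}" for c d
    unfolding I_w[OF that] gens wedge_list_sandwich[OF finite_FG_basis]
    by (simp only: sandwich_def P_def[symmetric] Q_def[symmetric] S_def[symmetric])
  have "ext_map ?X T (I_map n (bvec (?w a b))) =
      wedge_list (map (\<lambda>x. ext_incl ?X (T (bvec x))) (word_gens n (?w a b)))"
    unfolding I_w[OF w(3,4)] T_def
    using set_word_gens_subset
    by (intro ext_map_wedge_list finite_FG_basis linear_on_FG_gen[OF i] bvec_in_free_space) blast
  also have "\<dots> = sandwich (?f (\<lambda>x. T (bvec x)) a b) (?g (\<lambda>x. T (bvec x)) a b)"
    unfolding gens wedge_list_sandwich[OF finite_FG_basis]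
    by (simp only: sandwich_def PQS P_def[symmetric] Q_def[symmetric] S_def[symmetric])
  finally have L: "ext_map ?X T (I_map n (bvec (?w a b))) = \<dots>" .

  have single: "wedge_list [ext_incl ?X z] = ext_incl ?X z" for z :: "nat + nat \<Rightarrow> ratfun"
    by (simp add: wedge_list_Cons wedge_list_Nil wedge_one(2)[OF finite_FG_basis ext_incl_in_ext_space])
  have double: "wedge_list [ext_incl ?X y, ext_incl ?X z] = ext_incl ?X y \<and>\<^sub>e ext_incl ?X z"
    for y z :: "nat + nat \<Rightarrow> ratfun"
    by (simp add: wedge_list_Cons[of "ext_incl ?X y"] single)
  have ik: "i \<in> {1..n}" "i + 1 \<in> {1..n}" using i by auto
  have T_f: "ext_incl ?X (T (bvec (Inl i))) = (1 - inverse t0) \<cdot>\<^sub>v f1 + inverse t0_half \<cdot>\<^sub>v f2"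
    "ext_incl ?X (T (bvec (Inl (i + 1)))) = inverse t0_half \<cdot>\<^sub>v f1"
    unfolding T_def direct_sum_map_gen_bvec(1)[OF i ik(1)] direct_sum_map_gen_bvec(1)[OF i ik(2)] f1_def f2_def
    by (simp_all add: ext_incl_def linear_lin_ext)
  have T_g: "ext_incl ?X (T (bvec (Inr i))) = (- t0_half) \<cdot>\<^sub>v g2"
    "ext_incl ?X (T (bvec (Inr (i + 1)))) = (- t0_half) \<cdot>\<^sub>v g1 + (1 - t0) \<cdot>\<^sub>v g2"
    unfolding T_def direct_sum_map_gen_bvec(2)[OF i ik(1)] direct_sum_map_gen_bvec(2)[OF i ik(2)] g1_def g2_def
    by (simp_all add: ext_incl_def linear_lin_ext)
  have squares: "f1 \<and>\<^sub>e f1 = 0" "g2 \<and>\<^sub>e g2 = 0"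
    unfolding f1_def g2_def by (rule wedge_square[OF finite_FG_basis])+
  have anti: "f2 \<and>\<^sub>e f1 = - (f1 \<and>\<^sub>e f2)" "g2 \<and>\<^sub>e g1 = - (g1 \<and>\<^sub>e g2)"
    unfolding f1_def f2_def g1_def g2_def by (rule wedge_anticommute[OF finite_FG_basis])+
  \<comment> \<open>The 2-by-2 determinants of \<open>F\<close> and \<open>G\<close>.\<close>
  have T_ff: "((1 - inverse t0) \<cdot>\<^sub>v f1 + inverse t0_half \<cdot>\<^sub>v f2) \<and>\<^sub>e (inverse t0_half \<cdot>\<^sub>v f1) =
      (- inverse t0) \<cdot>\<^sub>v (f1 \<and>\<^sub>e f2)"
    unfolding wedge_bilinear squares anti
    by (simp add: fun_eq_iff smul_apply t0_def power2_eq_square)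
  have T_gg: "((- t0_half) \<cdot>\<^sub>v g2) \<and>\<^sub>e ((- t0_half) \<cdot>\<^sub>v g1 + (1 - t0) \<cdot>\<^sub>v g2) = (- t0) \<cdot>\<^sub>v (g1 \<and>\<^sub>e g2)"
    unfolding wedge_bilinear squares anti
    by (simp add: fun_eq_iff smul_apply t0_def power2_eq_square)
  have f_bvec: "?f bvec c d = (if c \<in> {3, 4} then if d \<in> {3, 4} then f1 \<and>\<^sub>e f2 else f1
      else if d \<in> {3, 4} then f2 else bvec {})" for c d
    by (cases "c \<in> {3, 4}"; cases "d \<in> {3, 4}")
      (simp_all only: pair_positions_def if_True if_False append.simps list.map single double
        wedge_list_Nil f1_def f2_def)
  have g_bvec: "?g bvec c d = (if c \<in> {1, 3} then if d \<in> {1, 3} then g1 \<and>\<^sub>e g2 else g1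
      else if d \<in> {1, 3} then g2 else bvec {})" for c d
    by (cases "c \<in> {1, 3}"; cases "d \<in> {1, 3}")
      (simp_all only: pair_positions_def if_True if_False append.simps list.map single double
        wedge_list_Nil g1_def g2_def)
  have f_T: "?f (\<lambda>x. T (bvec x)) c d = (if c \<in> {3, 4} then if d \<in> {3, 4}
        then (- inverse t0) \<cdot>\<^sub>v (f1 \<and>\<^sub>e f2) else (1 - inverse t0) \<cdot>\<^sub>v f1 + inverse t0_half \<cdot>\<^sub>v f2
      else if d \<in> {3, 4} then inverse t0_half \<cdot>\<^sub>v f1 else bvec {})" for c d
    by (cases "c \<in> {3, 4}"; cases "d \<in> {3, 4}")
      (simp_all only: pair_positions_def if_True if_False append.simps list.map single double
        wedge_list_Nil, simp_all only: T_f T_ff)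
  have g_T: "?g (\<lambda>x. T (bvec x)) c d = (if c \<in> {1, 3} then if d \<in> {1, 3}
        then (- t0) \<cdot>\<^sub>v (g1 \<and>\<^sub>e g2) else (- t0_half) \<cdot>\<^sub>v g2
      else if d \<in> {1, 3} then (- t0_half) \<cdot>\<^sub>v g1 + (1 - t0) \<cdot>\<^sub>v g2 else bvec {})" for c d
    by (cases "c \<in> {1, 3}"; cases "d \<in> {1, 3}")
      (simp_all only: pair_positions_def if_True if_False append.simps list.map single double
        wedge_list_Nil, simp_all only: T_g T_gg)

  \<comment> \<open>The right-hand side as a linear function of the vector put at positions \<open>i, i + 1\<close>.\<close>
  define J where "J r = I_map n (insert_pair u r v)" for r
  have J_lin: "linear_on UNIV J"
    unfolding J_def by (rule linear_on_comp[OF linear_on_insert_pair subset_UNIV linear_on_I_map])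
  have J_linear: "J (r + s) = J r + J s" "J (k \<cdot>\<^sub>v r) = k \<cdot>\<^sub>v J r"
    "J (- r) = - J r" "J (r - s) = J r - J s" for r s k
    using linear_on_add[OF J_lin] linear_on_smul[OF J_lin] linear_on_UNIV_uminus[OF J_lin]
      linear_on_UNIV_diff[OF J_lin] by simp_all
  have J_bvec: "J (bvec [c, d]) = sandwich
      (if c \<in> {3, 4} then if d \<in> {3, 4} then f1 \<and>\<^sub>e f2 else f1 else if d \<in> {3, 4} then f2 else bvec {})
      (if c \<in> {1, 3} then if d \<in> {1, 3} then g1 \<and>\<^sub>e g2 else g1 else if d \<in> {1, 3} then g2 else bvec {})"
    if "c \<in> {1..4}" "d \<in> {1..4}" for c d
    unfolding J_def insert_pair_bvec R[OF that] f_bvec g_bvec ..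
  have sandwich_linear:
    "sandwich (x + y) z = sandwich x z + sandwich y z" "sandwich (k \<cdot>\<^sub>v x) z = k \<cdot>\<^sub>v sandwich x z"
    "sandwich z (x + y) = sandwich z x + sandwich z y" "sandwich z (k \<cdot>\<^sub>v x) = k \<cdot>\<^sub>v sandwich z x" for x y z k
    by (simp_all add: sandwich_def wedge_bilinear)
  \<comment> \<open>One case for each basis vector of \<open>W \<otimes> W\<close>, compared coefficientwise.\<close>
  have "a = 1 \<or> a = 2 \<or> a = 3 \<or> a = 4" "b = 1 \<or> b = 2 \<or> b = 3 \<or> b = 4" using w(3,4) by auto
  then have "sandwich (?f (\<lambda>x. T (bvec x)) a b) (?g (\<lambda>x. T (bvec x)) a b) = J (R_basis (a, b))"
    unfolding f_T g_T
    by (elim disjE)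
      (simp_all add: R_basis_def J_linear J_bvec sandwich_linear del: One_nat_def,
       simp_all add: fun_eq_iff smul_apply t0_def Y_def del: One_nat_def,
       simp_all add: field_simps t0_half_nonzero power2_eq_square)
  with L show ?thesis unfolding J_def T_def by (rule HOL.trans)
qed

lemma linear_on_R_gen: "linear_on (tensor_power n) (R_gen n i)"
  unfolding R_gen_def tensor_power_def linear_on_restrict tensor_map_def by (rule linear_on_lin_ext)

lemma R_gen_closed:
  assumes i: "i \<in> {1..<n}" and v: "v \<in> tensor_power n"
  shows "R_gen n i v \<in> tensor_power n"
proof -
  have "R_gen n i v = lin_ext (tensor_basis n) (\<lambda>w. R_gen n i (bvec w)) v"
    using v unfolding tensor_power_def
    by (intro linear_on_eq_lin_ext finite_tensor_basis linear_on_R_gen[unfolded tensor_power_def])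
  also have "\<dots> \<in> tensor_power n"
    unfolding tensor_power_def
  proof (rule lin_ext_in_free_space)
    fix w assume "w \<in> tensor_basis n"
    then obtain u a b v where w: "w = u @ [a, b] @ v" "length u = i - 1" "length v = n - i - 1"
      "set u \<subseteq> {1..4}" "set v \<subseteq> {1..4}" "a \<in> {1..4}" "b \<in> {1..4}"
      by (rule tensor_basis_split[OF i])
    have "length u + length v + 2 = n" using i w(2,3) by auto
    then show "R_gen n i (bvec w) \<in> free_space (tensor_basis n)"
      unfolding w(1) R_gen_bvec[OF i w(2-7)]
      using insert_pair_closed[OF R_basis_in_free_space _ w(4,5)] by (simp add: tensor_power_def)
  qed
  finally show ?thesis .
qed

lemma I_map_closed: "v \<in> tensor_power n \<Longrightarrow> I_map n v \<in> FG_ext n"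
  using bij_betw_I_map by (rule bij_betw_apply)

lemma I_map_R_gen:
  assumes i: "i \<in> {1..<n}" and v: "v \<in> tensor_power n"
  shows "Psi n (braid_gen n i) (I_map n v) = I_map n (R_gen n i v)"
proof -
  let ?E = "ext_map (FG_basis n) (direct_sum_map (F_gen n i) (G_gen n i))"
  have "?E (I_map n v) = I_map n (R_gen n i v)"
  proof (rule linear_on_eqI[where S = "\<lambda>v. ?E (I_map n v)" and T = "\<lambda>v. I_map n (R_gen n i v)",
        OF finite_tensor_basis])
    show "linear_on (free_space (tensor_basis n)) (\<lambda>v. ?E (I_map n v))"
      by (rule linear_on_comp[OF linear_on_I_map subset_UNIV linear_on_ext_map[OF finite_FG_basis]])
    show "linear_on (free_space (tensor_basis n)) (\<lambda>v. I_map n (R_gen n i v))"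
      by (rule linear_on_comp[OF linear_on_R_gen[unfolded tensor_power_def] subset_UNIV linear_on_I_map])
    show "v \<in> free_space (tensor_basis n)" using v by (simp add: tensor_power_def)
    fix w assume "w \<in> tensor_basis n"
    then obtain u a b v where w: "w = u @ [a, b] @ v" "length u = i - 1" "length v = n - i - 1"
      "set u \<subseteq> {1..4}" "set v \<subseteq> {1..4}" "a \<in> {1..4}" "b \<in> {1..4}"
      by (rule tensor_basis_split[OF i])
    show "?E (I_map n (bvec w)) = I_map n (R_gen n i (bvec w))"
      unfolding w(1) R_gen_bvec[OF i w(2-7)] by (rule I_map_R_gen_bvec[OF i w(2-7)])
  qed
  then show ?thesis
    by (simp add: Psi_braid_gen[OF i] I_map_closed[OF v])
qed

theorem proposition2p4:
  fixes n :: nat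
  assumes "n \<ge> 1"
  shows "b_R n \<in> hom (braid_group n) (GL (tensor_power n))
    \<and> Psi n \<in> hom (braid_group n) (GL (FG_ext n))
    \<and> linear_on (tensor_power n) (I_map n)
    \<and> bij_betw (I_map n) (tensor_power n) (FG_ext n)
    \<and> (\<forall>b\<in>carrier (braid_group n). \<forall>v\<in>tensor_power n.
          Psi n b (I_map n v) = I_map n (b_R n b v))"
proof -
  let ?B = "braid_group n" and ?V = "tensor_power n"
  let ?J = "inv_into ?V (I_map n)"
  define h where "h b = (\<lambda>v\<in>?V. ?J (Psi n b (I_map n v)))" for b
  have group: "group (GL ?V)" unfolding tensor_power_def by (rule group_GL)
  have inj: "inj_on (I_map n) ?V" and surj: "I_map n ` ?V = FG_ext n"
    using bij_betw_I_map by (auto simp: bij_betw_def)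
  have h_hom: "h \<in> hom ?B (GL ?V)"
    using conjugate_hom_GL[OF group_braid_group Psi_hom[unfolded FG_ext_def ext_space_def] linear_on_I_map
        bij_betw_I_map[unfolded FG_ext_def ext_space_def tensor_power_def]]
    unfolding h_def tensor_power_def .
  have h_gen: "h (braid_gen n i) = R_gen n i" if i: "i \<in> {1..<n}" for i
  proof
    fix v
    show "h (braid_gen n i) v = R_gen n i v"
    proof (cases "v \<in> ?V")
      case True
      then show ?thesis
        using inv_into_f_f[OF inj R_gen_closed[OF i True]] by (simp add: h_def I_map_R_gen[OF i True])
    qed (simp add: h_def R_gen_def)
  qed
  have images: "braid_images n (GL ?V) (R_gen n)"
    using braid_images_of_hom[OF group h_hom]
      braid_images_cong[of n "\<lambda>i. h (braid_gen n i)" "R_gen n", OF h_gen] by blast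
  have b_R: "b_R n b = h b" if "b \<in> carrier ?B" for b
    unfolding b_R_def using braid_lift_unique[OF group images h_hom h_gen that] by simp
  have "b_R n \<in> hom ?B (GL ?V)"
    unfolding b_R_def by (rule braid_lift_hom[OF group images])
  moreover have "Psi n b (I_map n v) = I_map n (b_R n b v)" if "b \<in> carrier ?B" "v \<in> ?V" for b v
  proof -
    have "Psi n b (I_map n v) \<in> FG_ext n"
      using hom_in_carrier[OF Psi_hom that(1)] I_map_closed[OF that(2)] by (rule GL_closed)
    then show ?thesis
      using that by (simp add: b_R h_def f_inv_into_f surj)
  qed
  ultimately show ?thesis
    using Psi_hom linear_on_I_map bij_betw_I_map by blast
qed

end
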